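(* Let $K$ and $K'$ be alternating knots. If $K$ and $K'$ are isomorphic by extended mutation (that is, $K'$ is obtained from $K$ by an extended mutation), then $K$ and $K'$ have the same enlacement graph: $LG(K)\cong LG(K')$.
   Context: Alternating knots are represented by reduced alternating diagrams on $S^2$. **Enlacement graph.** Following the diagram once along the knot and recording the crossings gives a cyclic word in which each crossing occurs twice. $LG$ is the simple graph whose vertices are the crossings, two crossings $x,y$ being adjacent if and only if their occurrences alternate in the word ($\dots x\dots y\dots x\dots y\dots$). Equivalently, it is the intersection graph of the chords of the chord diagram of the knot diagram. Graphs are compared up to isomorphism (no labels). **2-tangle.** A 2-tangle is the part of the diagram inside a disc of $S^2$ whose boundary meets the diagram in 4 non-crossing points. A single crossing is also regarded as a 2-tangle. **Classical mutation.** This applies to one 2-tangle one of the following symmetries and leaves the rest of the diagram unchanged: $Id$ (identity); $H$ (reflection of the projection in a horizontal axis together with exchange of over and under at each crossing of the tangle); $V$ (the same with a vertical axis); $\pi$ (rotation by $180^\circ$ in the projection surface). **Bundle and tangle flype.** Decompose a knot diagram into 2-tangles and replace each 2-tangle by a single crossing point, obtaining a link diagram $TK$. A bundle is a set of 2-tangles whose crossing points form a digonal torsad in $TK$, i.e. a sequence of half twists on two strings, so that the tangles form a chain $T_1,\dots,T_m$ in which consecutive tangles are joined by two strands. A tangle flype is the analogue of a flype in which the active crossing is replaced by an active tangle that is moved past other tangles of its bundle. Compositions of tangle flypes realize the permutations of the tangles in the bundle. **Extended mutation.** An extended mutation is a map from the set of knots to itself obtained as a composition of: (1) classical mutations, i.e.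 symmetries $Id$, $H$, $V$ or $\pi$ on 2-tangles; (2) permutations of tangles in the same bundle (tangle flypes). *)

theory Defs
  imports
    "HOL-Combinatorics.Orbits"
    "HOL-Library.Sublist"
begin

section \<open>Four-valent maps on the sphere\<close>

text \<open>
  A projection is a four-valent graph cellularly embedded in an oriented closed surface, given
  by its darts (half-edges): \<open>rot\<close> sends a dart to the next one counterclockwise at the same
  vertex and \<open>twin\<close> to the other half of the same edge. Orientation-preserving homeomorphisms of
  the surface become isomorphisms of this structure. Values of \<open>rot\<close> and \<open>twin\<close> outside
  \<open>darts\<close> are irrelevant.
\<close>

record 'd projection =
  darts :: "'d set"
  rot :: "'d \<Rightarrow> 'd"
  twin :: "'d \<Rightarrow> 'd"

definition four_valent :: "('d, 'm) projection_scheme \<Rightarrow> bool" where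
  "four_valent M \<longleftrightarrow> finite (darts M) \<and>
     (\<forall>d\<in>darts M.
        rot M d \<in> darts M \<and> (rot M ^^ 4) d = d \<and> (rot M ^^ 2) d \<noteq> d \<and>
        twin M d \<in> darts M \<and> twin M (twin M d) = d \<and> twin M d \<noteq> d)"

definition vertex :: "('d, 'm) projection_scheme \<Rightarrow> 'd \<Rightarrow> 'd set" where
  "vertex M d = orbit (rot M) d"

definition vertices :: "('d, 'm) projection_scheme \<Rightarrow> 'd set set" where
  "vertices M = vertex M ` darts M"

definition edges :: "('d, 'm) projection_scheme \<Rightarrow> 'd set set" where
  "edges M = (\<lambda>d. {d, twin M d}) ` darts M"

text \<open>
  \<open>face M d\<close> is the region to the right of \<open>d\<close> when leaving the vertex along \<open>d\<close>. Every dart of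
  this orbit stands for one corner of the region, namely the corner between the dart and its
  clockwise neighbour.
\<close>

definition face :: "('d, 'm) projection_scheme \<Rightarrow> 'd \<Rightarrow> 'd set" where
  "face M d = orbit (rot M \<circ> twin M) d"

definition faces :: "('d, 'm) projection_scheme \<Rightarrow> 'd set set" where
  "faces M = face M ` darts M"

definition connected_map :: "('d, 'm) projection_scheme \<Rightarrow> bool" where
  "connected_map M \<longleftrightarrow>
     (\<forall>d\<in>darts M. \<forall>e\<in>darts M.
        (d, e) \<in> ({(x, rot M x) | x. x \<in> darts M} \<union> {(x, twin M x) | x. x \<in> darts M})\<^sup>*)"

text \<open>The surface is \<open>S\<^sup>2\<close>: connectedness and Euler characteristic 2.\<close>

definition spherical :: "('d, 'm) projection_scheme \<Rightarrow> bool" where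
  "spherical M \<longleftrightarrow> four_valent M \<and> darts M \<noteq> {} \<and> connected_map M \<and>
     card (vertices M) + card (faces M) = card (edges M) + 2"


section \<open>Knot diagrams\<close>

text \<open>\<open>over\<close> is the set of the darts that belong to the upper strand at their crossing.\<close>

record 'd diagram = "'d projection" +
  over :: "'d set"

definition diagram_iso :: "'a diagram \<Rightarrow> 'b diagram \<Rightarrow> bool" where
  "diagram_iso D D' \<longleftrightarrow>
     (\<exists>h. bij_betw h (darts D) (darts D') \<and>
        (\<forall>d\<in>darts D. h (rot D d) = rot D' (h d) \<and> h (twin D d) = twin D' (h d) \<and>
           (h d \<in> over D' \<longleftrightarrow> d \<in> over D)))"

text \<open>
  A dart also stands for a passage of the knot through a crossing, which it leaves along that
  dart; \<open>next_passage\<close> follows the edge to its other end and goes straight on there.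
\<close>

definition next_passage :: "('d, 'm) projection_scheme \<Rightarrow> 'd \<Rightarrow> 'd" where
  "next_passage M d = rot M (rot M (twin M d))"

text \<open>
  One component: following the knot from any passage, together with following it in the opposite
  direction, exhausts all darts. The diagram without darts is the round circle.
\<close>

definition knot_diagram :: "'d diagram \<Rightarrow> bool" where
  "knot_diagram D \<longleftrightarrow> (darts D = {} \<or> spherical D) \<and>
     over D \<subseteq> darts D \<and>
     (\<forall>d\<in>darts D. rot D d \<in> over D \<longleftrightarrow> d \<notin> over D) \<and>
     (\<forall>d\<in>darts D. darts D = orbit (next_passage D) d \<union> orbit (next_passage D) (twin D d))"

definition alternating :: "'d diagram \<Rightarrow> bool" where
  "alternating D \<longleftrightarrow> (\<forall>d\<in>darts D. next_passage D d \<in> over D \<longleftrightarrow> d \<notin> over D)"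

text \<open>
  A crossing is nugatory if a circle on the sphere meets the diagram only there, separating
  opposite corners, i.e. if two opposite corners belong to the same region.
\<close>

definition reduced :: "'d diagram \<Rightarrow> bool" where
  "reduced D \<longleftrightarrow> (\<forall>d\<in>darts D. rot D (rot D d) \<notin> face D d)"

text \<open>
  Alternating knots are represented by reduced alternating diagrams. That the choice of the
  diagram is immaterial for extended mutation is explained at \<open>extended_mutation\<close>.
\<close>

definition alternating_knot :: "'d diagram \<Rightarrow> bool" where
  "alternating_knot K \<longleftrightarrow> knot_diagram K \<and> alternating K \<and> reduced K"


section \<open>The enlacement graph\<close>

record 'v sgraph =
  verts :: "'v set"
  adj :: "'v \<Rightarrow> 'v \<Rightarrow> bool"

definition graph_iso :: "'v sgraph \<Rightarrow> 'w sgraph \<Rightarrow> bool" where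
  "graph_iso G H \<longleftrightarrow>
     (\<exists>h. bij_betw h (verts G) (verts H) \<and>
        (\<forall>x\<in>verts G. \<forall>y\<in>verts G. adj H (h x) (h y) \<longleftrightarrow> adj G x y))"

definition gauss_word :: "'d diagram \<Rightarrow> 'd \<Rightarrow> 'd set list" where
  "gauss_word K d =
     map (\<lambda>i. vertex K ((next_passage K ^^ i) d)) [0..<card (orbit (next_passage K) d)]"

definition alternate_in :: "'c list \<Rightarrow> 'c \<Rightarrow> 'c \<Rightarrow> bool" where
  "alternate_in w x y \<longleftrightarrow> subseq [x, y, x, y] w \<or> subseq [y, x, y, x] w"

text \<open>
  For a knot diagram the choice of the starting passage \<open>d\<close> does not matter: it changes the word
  by a rotation or a reversal.
\<close>

definition LG :: "'d diagram \<Rightarrow> 'd set sgraph" where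
  "LG K = \<lparr> verts = vertices K,
     adj = (\<lambda>x y. x \<in> vertices K \<and> y \<in> vertices K \<and> x \<noteq> y \<and>
        (\<exists>d\<in>darts K. alternate_in (gauss_word K d) x y)) \<rparr>"


section \<open>2-tangles and their symmetries\<close>

datatype corner = NW | NE | SE | SW

text \<open>
  The complement of the disc is shrunk to one additional four-valent vertex, whose darts
  \<open>stub T NW, \<dots>, stub T SW\<close> start at the boundary points and point into the disc. Edges between
  two stubs are strands without crossings. The clockwise order NW, NE, SE, SW around the disc is
  the counterclockwise order around the additional vertex.
\<close>

record 'd tangle = "'d diagram" +
  stub :: "corner \<Rightarrow> 'd"

definition inner :: "'d tangle \<Rightarrow> 'd set" where
  "inner T = darts T - range (stub T)"

definition tangle :: "'d tangle \<Rightarrow> bool" where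
  "tangle T \<longleftrightarrow> spherical T \<and> stub T NW \<in> darts T \<and>
     rot T (stub T NW) = stub T NE \<and>
     rot T (stub T NE) = stub T SE \<and>
     rot T (stub T SE) = stub T SW \<and>
     over T \<subseteq> inner T \<and>
     (\<forall>d\<in>inner T. rot T d \<in> over T \<longleftrightarrow> d \<notin> over T)"

datatype symmetry = Ident | Hor | Ver | Rot

fun move_corner :: "symmetry \<Rightarrow> corner \<Rightarrow> corner" where
  "move_corner Ident c = c"
| "move_corner Hor c = (case c of NW \<Rightarrow> SW | NE \<Rightarrow> SE | SE \<Rightarrow> NE | SW \<Rightarrow> NW)"
| "move_corner Ver c = (case c of NW \<Rightarrow> NE | NE \<Rightarrow> NW | SE \<Rightarrow> SW | SW \<Rightarrow> SE)"
| "move_corner Rot c = (case c of NW \<Rightarrow> SE | NE \<Rightarrow> SW | SE \<Rightarrow> NW | SW \<Rightarrow> NE)"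

text \<open>
  \<open>Hor\<close> and \<open>Ver\<close> reflect the projection, so \<open>rot\<close> is inverted (its inverse is its third power),
  and exchange over and under; \<open>Rot\<close> is the rotation by 180 degrees in the projection surface.
\<close>

definition act :: "symmetry \<Rightarrow> 'd tangle \<Rightarrow> 'd tangle" where
  "act g T =
     (if g = Hor \<or> g = Ver
      then T\<lparr> rot := rot T ^^ 3, over := inner T - over T, stub := stub T \<circ> move_corner g \<rparr>
      else T\<lparr> stub := stub T \<circ> move_corner g \<rparr>)"


section \<open>Decompositions into 2-tangles\<close>

text \<open>
  \<open>TK\<close> is the projection obtained by replacing every 2-tangle by a crossing point. \<open>F\<close> contains
  one dart of each vertex of \<open>TK\<close>; this dart points to the NW corner of the tangle at that
  vertex and also serves as the name of the vertex.
\<close>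

definition frame :: "('d, 'm) projection_scheme \<Rightarrow> 'd set \<Rightarrow> bool" where
  "frame TK F \<longleftrightarrow> F \<subseteq> darts TK \<and> (\<forall>d\<in>darts TK. \<exists>!f. f \<in> F \<and> f \<in> vertex TK d)"

definition corner_dart :: "('d, 'm) projection_scheme \<Rightarrow> 'd \<Rightarrow> corner \<Rightarrow> 'd" where
  "corner_dart TK f c =
     (case c of NW \<Rightarrow> f | SW \<Rightarrow> rot TK f | SE \<Rightarrow> (rot TK ^^ 2) f | NE \<Rightarrow> (rot TK ^^ 3) f)"

text \<open>
  \<open>strand TK F T x y\<close>: starting at the dart \<open>x\<close> (of the tangle \<open>T (fst x)\<close>) and running along
  strands without crossings of the tangles and along edges of \<open>TK\<close>, one arrives at the dart \<open>y\<close>.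
\<close>

inductive strand ::
  "('a, 'm) projection_scheme \<Rightarrow> 'a set \<Rightarrow> ('a \<Rightarrow> 'b tangle) \<Rightarrow> 'a \<times> 'b \<Rightarrow> 'a \<times> 'b \<Rightarrow> bool"
  for TK F T where
  start: "strand TK F T (f, d) (f, twin (T f) d)"
| pass: "\<lbrakk>strand TK F T x (f, stub (T f) c); f \<in> F; g \<in> F;
          twin TK (corner_dart TK f c) = corner_dart TK g c'\<rbrakk>
         \<Longrightarrow> strand TK F T x (g, twin (T g) (stub (T g) c'))"

definition fill_darts :: "'a set \<Rightarrow> ('a \<Rightarrow> 'b tangle) \<Rightarrow> ('a \<times> 'b) set" where
  "fill_darts F T = Sigma F (\<lambda>f. inner (T f))"

text \<open>The diagram obtained by inserting the tangles \<open>T f\<close> at the vertices of \<open>TK\<close>.\<close>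

definition fill ::
  "('a, 'm) projection_scheme \<Rightarrow> 'a set \<Rightarrow> ('a \<Rightarrow> 'b tangle) \<Rightarrow> ('a \<times> 'b) diagram" where
  "fill TK F T =
     \<lparr> darts = fill_darts F T,
       rot = (\<lambda>(f, d). (f, rot (T f) d)),
       twin = (\<lambda>x. THE y. y \<in> fill_darts F T \<and> strand TK F T x y),
       over = Sigma F (\<lambda>f. over (T f)) \<rparr>"

text \<open>
  Inserting tangles may also close up crossingless components, which \<open>fill\<close> would drop; there
  are none iff every strand entering a tangle eventually reaches a crossing.
\<close>

definition no_free_circle ::
  "('a, 'm) projection_scheme \<Rightarrow> 'a set \<Rightarrow> ('a \<Rightarrow> 'b tangle) \<Rightarrow> bool" where
  "no_free_circle TK F T \<longleftrightarrow>
     (\<forall>f\<in>F. \<forall>c. \<exists>y\<in>fill_darts F T. strand TK F T (f, stub (T f) c) y)"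

definition decomposition ::
  "'a projection \<Rightarrow> 'a set \<Rightarrow> ('a \<Rightarrow> 'b tangle) \<Rightarrow> 'd diagram \<Rightarrow> bool" where
  "decomposition TK F T D \<longleftrightarrow> spherical TK \<and> frame TK F \<and> (\<forall>f\<in>F. tangle (T f)) \<and>
     no_free_circle TK F T \<and> diagram_iso (fill TK F T) D"


section \<open>Extended mutation\<close>

text \<open>
  Dart names are immaterial, so that natural numbers suffice to name the darts of all diagrams,
  projections and tangles.
\<close>

definition classical_mutation :: "nat diagram \<Rightarrow> nat diagram \<Rightarrow> bool" where
  "classical_mutation D D' \<longleftrightarrow>
     (\<exists>(TK :: nat projection) F (T :: nat \<Rightarrow> nat tangle) f g.
        f \<in> F \<and> decomposition TK F T D \<and> decomposition TK F (T(f := act g (T f))) D')"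

text \<open>
  A bundle, listed from west to east along its axis: the NE and SE corners of each tangle are
  joined to the NW and SW corners of the following one. The region between the two joining edges
  then automatically is a digon of \<open>TK\<close>.
\<close>

definition is_bundle :: "('d, 'm) projection_scheme \<Rightarrow> 'd set \<Rightarrow> 'd list \<Rightarrow> bool" where
  "is_bundle TK F fs \<longleftrightarrow> distinct fs \<and> set fs \<subseteq> F \<and>
     (\<forall>i. Suc i < length fs \<longrightarrow>
        twin TK (corner_dart TK (fs ! i) NE) = corner_dart TK (fs ! Suc i) NW \<and>
        twin TK (corner_dart TK (fs ! i) SE) = corner_dart TK (fs ! Suc i) SW)"

text \<open>
  The tangles of a bundle are permuted by \<open>p\<close>. In a flype the tangle passed by the active crossing
  turns over about the axis of the bundle; \<open>U\<close> is the set of the places whose new tangle has been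
  turned over. A permutation without turning over is the case \<open>U = {}\<close>; an ordinary flype is the
  case of two tangles, the active one a single crossing.
\<close>

definition bundle_permutation :: "nat diagram \<Rightarrow> nat diagram \<Rightarrow> bool" where
  "bundle_permutation D D' \<longleftrightarrow>
     (\<exists>(TK :: nat projection) F (T :: nat \<Rightarrow> nat tangle) fs p U.
        is_bundle TK F fs \<and> p permutes set fs \<and> U \<subseteq> set fs \<and>
        decomposition TK F T D \<and>
        decomposition TK F (\<lambda>f. act (if f \<in> U then Hor else Ident) (T (p f))) D')"

definition mutation_step :: "nat diagram \<Rightarrow> nat diagram \<Rightarrow> bool" where
  "mutation_step D D' \<longleftrightarrow> knot_diagram D \<and> knot_diagram D' \<and>
     (diagram_iso D D' \<or> classical_mutation D D' \<or> bundle_permutation D D')"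

text \<open>
  By the Tait flyping theorem, reduced alternating diagrams of the same knot are related by
  isomorphisms, flypes, and viewing the projection sphere from its other side. Flypes are bundle
  permutations, and the change of side is the symmetry \<open>Hor\<close> of a tangle that contains all
  crossings. So the relation does not depend on the diagrams chosen to represent two alternating
  knots.
\<close>

definition extended_mutation :: "nat diagram \<Rightarrow> nat diagram \<Rightarrow> bool" where
  "extended_mutation = mutation_step\<^sup>*\<^sup>*"

end

theory Submission
  imports Defs
begin

text \<open>
  Fix a crossing \<open>x\<close> of a knot diagram. There is exactly one partition of the edges into two colours
  such that the knot changes its colour at \<open>x\<close> and at no other crossing: the two halves into which
  \<open>x\<close> cuts the knot. A crossing \<open>y \<noteq> x\<close> is interlaced with \<open>x\<close> iff the two strands at \<open>y\<close> have
  different colours. Unlike the Gauss word, this description is local, so that such colourings can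
  be followed through a mutation tangle by tangle. Each tangle keeps its colouring, possibly with
  the two colours exchanged, which is harmless. That the pieces fit together again depends on one
  fact only: an even number of the four ends of a tangle have a given colour.
\<close>


section \<open>Four-valent maps\<close>

text \<open>Adjacency is read at a crossing \<open>y\<close> from its bend, that is, from whether
  \<open>d\<close> and \<open>rot D d\<close> have the same colour. Any colouring that satisfies
  \<open>halving\<close> gives the right answer, so a mutation only has to carry each halving of
  \<open>x\<close> to some halving of the image of \<open>x\<close> with the same bends at the other
  crossings; the result is never compared with the two halves of the new knot. Such transports
  compose along a chain of mutations, and Gauss words are consulted at its two ends only. The
  obstacle is that an edge of a filled projection is not local: it may run through many tangles
  along strands without crossings, and a mutation reroutes it. Hence colourings are extended to the
  stubs, where the condition on an edge splits into one condition per edge of a tangle and one per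
  gluing. A tangle then meets its surroundings in four Booleans. Evenness makes them constant or
  splits the corners into two pairs, and every symmetry maps each such pair to itself or to the
  other one.\<close>

lemma self_in_orbit_finite:
  assumes "finite S" and "f ` S \<subseteq> S" and "inj_on f S" and "d \<in> S"
  shows "d \<in> orbit f d"
proof -
  \<comment> \<open>\<open>orbit f d\<close> begins at \<open>f d\<close>, so the claim is one of
    periodicity. It is known for permutations of the whole type; \<open>f\<close> is arbitrary
    outside \<open>S\<close>, and \<open>g\<close> replaces it there by the identity.\<close>
  define g where "g x = (if x \<in> S then f x else x)" for x
  have "bij_betw f S S"
    using assms by (simp add: bij_betw_def endo_inj_surj)
  then have "bij_betw g S S"
    by (simp add: g_def cong: bij_betw_cong)
  then have "g permutes S"
    by (rule bij_imp_permutes) (simp add: g_def)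
  then have "permutation g"
    using assms(1) by (auto simp: permutation_permutes)
  then have "d \<in> orbit g d"
    by (rule permutation_self_in_orbit)
  also have "orbit g d = orbit f d"
    by (rule orbit_cong0[of d S]) (use assms in \<open>auto simp: g_def\<close>)
  finally show ?thesis .
qed

text \<open>The conjugacy is required on an invariant set, because \<open>rot\<close> and
  \<open>twin\<close> have arbitrary values away from the darts.\<close>

lemma orbit_image_conj:
  assumes "d \<in> S" and "\<And>e. e \<in> S \<Longrightarrow> f e \<in> S" and "\<And>e. e \<in> S \<Longrightarrow> h (f e) = g (h e)"
  shows "h ` orbit f d = orbit g (h d)"
proof (intro equalityI subsetI)
  fix y assume "y \<in> h ` orbit f d"
  then obtain e where e: "e \<in> orbit f d" "y = h e" by auto
  from e(1) have "e \<in> S \<and> h e \<in> orbit g (h d)"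
    by induct (use assms in \<open>auto intro: orbit.intros orbit_eqI\<close>)
  then show "y \<in> orbit g (h d)" using e by simp
next
  fix y assume "y \<in> orbit g (h d)"
  then have "\<exists>e. e \<in> S \<and> e \<in> orbit f d \<and> y = h e"
    by induct (use assms in \<open>metis orbit.intros\<close>)+
  then show "y \<in> h ` orbit f d" by auto
qed

lemma four_valentD:
  assumes "four_valent M" and "d \<in> darts M"
  shows "rot M d \<in> darts M" and "rot M (rot M (rot M (rot M d))) = d" and "rot M (rot M d) \<noteq> d"
    and "twin M d \<in> darts M" and "twin M (twin M d) = d" and "twin M d \<noteq> d"
  using assms by (auto simp: four_valent_def numeral_eq_Suc)

lemma four_valent_finite: "four_valent M \<Longrightarrow> finite (darts M)"
  by (simp add: four_valent_def)

lemma vertex_eq: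
  assumes "four_valent M" and "d \<in> darts M"
  shows "vertex M d = {d, rot M d, rot M (rot M d), rot M (rot M (rot M d))}"
proof -
  have "(rot M ^^ 4) d = d" using assms by (simp add: four_valent_def)
  then have "orbit (rot M) d = {(rot M ^^ m) d |m. m < 4}"
    by (rule orbit_altdef_bounded) simp
  also have "\<dots> = (\<lambda>m. (rot M ^^ m) d) ` {..<4}" by auto
  also have "{..<4::nat} = {0, 1, 2, 3}" by auto
  finally show ?thesis by (simp add: vertex_def numeral_eq_Suc)
qed

lemma vertex_subset: "four_valent M \<Longrightarrow> d \<in> darts M \<Longrightarrow> vertex M d \<subseteq> darts M"
  by (auto simp: vertex_eq dest: four_valentD)

lemma self_in_vertex: "four_valent M \<Longrightarrow> d \<in> darts M \<Longrightarrow> d \<in> vertex M d"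
  by (simp add: vertex_eq)

lemma vertex_eqI:
  assumes "four_valent M" and "d \<in> darts M" and "e \<in> vertex M d"
  shows "vertex M e = vertex M d"
  using orbit_cyclic_eq3[OF cyclic_on_singleI[OF _ refl]] self_in_vertex[OF assms(1,2)] assms(3)
  unfolding vertex_def by metis

lemma vertices_subset: "four_valent M \<Longrightarrow> x \<in> vertices M \<Longrightarrow> x \<subseteq> darts M"
  using vertex_subset by (fastforce simp: vertices_def)

lemma vertex_of_mem:
  assumes "four_valent M" and "x \<in> vertices M" and "d \<in> x"
  shows "vertex M d = x"
  using assms vertex_eqI by (fastforce simp: vertices_def)

lemma mem_vertex_iff:
  assumes "four_valent M" and "x \<in> vertices M" and "d \<in> darts M"
  shows "d \<in> x \<longleftrightarrow> vertex M d = x"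
  using assms self_in_vertex vertex_of_mem by metis

lemma rot_mem_vertex:
  assumes "four_valent M" and "x \<in> vertices M" and "d \<in> darts M"
  shows "rot M d \<in> x \<longleftrightarrow> d \<in> x"
proof -
  have "vertex M (rot M d) = vertex M d"
    using assms by (intro vertex_eqI) (auto simp: vertex_eq)
  then show ?thesis using assms by (simp add: mem_vertex_iff four_valentD)
qed

section \<open>Interlacement by two-colourings of the knot\<close>

text \<open>\<open>\<phi>\<close> colours edges, hence the clause on \<open>twin\<close>. The darts
  \<open>d\<close> and \<open>rot M (rot M d)\<close> are the two ends of one strand at a crossing,
  and both strands change colour exactly at \<open>x\<close>. Only equalities of colours occur, so
  the complement of a halving is again one.\<close>

definition halving :: "('d, 'm) projection_scheme \<Rightarrow> 'd set \<Rightarrow> ('d \<Rightarrow> bool) \<Rightarrow> bool" where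
  "halving M x \<phi> \<longleftrightarrow> (\<forall>d\<in>darts M. (\<phi> (twin M d) \<longleftrightarrow> \<phi> d) \<and>
     ((\<phi> (rot M (rot M d)) \<longleftrightarrow> \<phi> d) \<longleftrightarrow> d \<notin> x))"

lemma knot_four_valent: "knot_diagram D \<Longrightarrow> four_valent D"
  by (auto simp: knot_diagram_def spherical_def four_valent_def)

section \<open>Traversals of a knot in its two directions\<close>

locale knot =
  fixes D :: "'d diagram"
  assumes knot: "knot_diagram D"
begin

lemma fv: "four_valent D"
  using knot by (rule knot_four_valent)

lemmas dartD = four_valentD[OF fv]

abbreviation "\<sigma> \<equiv> next_passage D"

lemma next_in: "d \<in> darts D \<Longrightarrow> \<sigma> d \<in> darts D"
  by (simp add: next_passage_def dartD)

lemma next_pow_in: "d \<in> darts D \<Longrightarrow> (\<sigma> ^^ k) d \<in> darts D"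
  by (induct k) (auto intro: next_in)

lemma prev_next: "d \<in> darts D \<Longrightarrow> twin D (rot D (rot D (\<sigma> d))) = d"
  by (simp add: next_passage_def dartD)

lemma self_in_passages: "d \<in> darts D \<Longrightarrow> d \<in> orbit \<sigma> d"
proof (rule self_in_orbit_finite)
  show "inj_on \<sigma> (darts D)" by (rule inj_on_inverseI) (rule prev_next)
qed (use fv next_in in \<open>auto simp: four_valent_finite\<close>)

text \<open>A return along the same edge in the opposite direction would make the path between a
  palindrome. Cutting one passage off at both ends lowers \<open>k\<close> by two, until
  \<open>twin\<close> (\<open>k = 0\<close>) or the half turn at a crossing (\<open>k = 1\<close>)
  would fix a dart.\<close>

lemma next_pow_neq_twin: "d \<in> darts D \<Longrightarrow> (\<sigma> ^^ k) d \<noteq> twin D d"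
proof (induct k arbitrary: d rule: less_induct)
  case (less k)
  consider "k = 0" | "k = 1" | j where "k = Suc (Suc j)"
    by (metis One_nat_def not0_implies_Suc)
  then show ?case
  proof cases
    case 3
    have in_darts: "\<sigma> d \<in> darts D" by (rule next_in) (rule less)
    show ?thesis
    proof
      assume "(\<sigma> ^^ k) d = twin D d"
      then have "\<sigma> ((\<sigma> ^^ j) (\<sigma> d)) = twin D d"
        using 3 by (simp add: funpow_swap1)
      then have "(\<sigma> ^^ j) (\<sigma> d) = twin D (rot D (rot D (twin D d)))"
        using prev_next[OF next_pow_in[OF in_darts]] by metis
      then have "(\<sigma> ^^ j) (\<sigma> d) = twin D (\<sigma> d)"
        by (simp add: next_passage_def)
      with less(1)[of j "\<sigma> d"] 3 in_darts show False by simp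
    qed
  next
    case 1
    then show ?thesis using dartD(6)[OF less(2)] by (metis funpow_0)
  next
    case 2
    then show ?thesis using dartD(3,4)[of d] dartD(3)[of "twin D d"] less(2)
      by (simp add: next_passage_def)
  qed
qed

lemma orbit_mem_in: "d \<in> darts D \<Longrightarrow> e \<in> orbit \<sigma> d \<Longrightarrow> e \<in> darts D"
  using next_pow_in by (auto simp: orbit_altdef)

lemma orbit_mem_eq: "d \<in> darts D \<Longrightarrow> e \<in> orbit \<sigma> d \<Longrightarrow> orbit \<sigma> e = orbit \<sigma> d"
  by (metis cyclic_on_singleI orbit_cyclic_eq3 self_in_passages)

text \<open>The two directions of travel together cover all darts because there is one component,
  and they are disjoint by \<open>next_pow_neq_twin\<close>. So a traversal amounts to an
  orientation of every edge.\<close>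

lemma twin_in_orbit:
  assumes "d \<in> darts D" and "e \<in> darts D"
  shows "twin D e \<in> orbit \<sigma> d \<longleftrightarrow> e \<notin> orbit \<sigma> d"
proof
  assume "twin D e \<in> orbit \<sigma> d"
  show "e \<notin> orbit \<sigma> d"
  proof
    assume "e \<in> orbit \<sigma> d"
    then have "twin D e \<in> orbit \<sigma> e"
      using \<open>twin D e \<in> orbit \<sigma> d\<close> assms orbit_mem_eq by blast
    then show False
      using next_pow_neq_twin[OF assms(2)] unfolding orbit_altdef by (auto dest: sym)
  qed
next
  assume e: "e \<notin> orbit \<sigma> d"
  have "d \<in> orbit \<sigma> e \<union> orbit \<sigma> (twin D e)"
    using knot assms by (auto simp: knot_diagram_def)
  then show "twin D e \<in> orbit \<sigma> d"
    using e assms by (metis UnE dartD(4) orbit_mem_eq self_in_passages)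
qed

lemma opposite_in_orbit:
  assumes "d \<in> darts D" and "e \<in> darts D"
  shows "rot D (rot D e) \<in> orbit \<sigma> d \<longleftrightarrow> e \<notin> orbit \<sigma> d"
proof -
  have "\<sigma> (twin D e) = rot D (rot D e)"
    using assms by (simp add: next_passage_def dartD)
  moreover have "\<sigma> (twin D e) \<in> orbit \<sigma> d \<longleftrightarrow> twin D e \<in> orbit \<sigma> d"
    using assms by (metis dartD(4) orbit.base orbit.step orbit_mem_eq next_in self_in_passages)
  ultimately show ?thesis
    using twin_in_orbit[OF assms] by simp
qed

end

locale knot_tour = knot +
  fixes d\<^sub>0
  assumes d\<^sub>0: "d\<^sub>0 \<in> darts D"
begin

abbreviation "tour \<equiv> orbit \<sigma> d\<^sub>0"

abbreviation "len \<equiv> card tour"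

abbreviation "pass i \<equiv> (\<sigma> ^^ i) d\<^sub>0"

lemma pass_bij: "bij_betw pass {..<len} tour" and pass_len: "pass len = d\<^sub>0"
proof -
  let ?n = "funpow_dist1 \<sigma> d\<^sub>0 d\<^sub>0"
  note self = self_in_passages[OF d\<^sub>0]
  have bij: "bij_betw pass {0..<?n} tour"
    using inj_on_funpow_dist1[OF self] orbit_conv_funpow_dist1[OF self]
    unfolding bij_betw_def by blast
  then have "?n = len"
    using bij_betw_same_card by fastforce
  with bij funpow_dist1_prop[OF self] show "bij_betw pass {..<len} tour" "pass len = d\<^sub>0"
    by (simp_all add: atLeast0LessThan)
qed

lemma pass_in: "pass i \<in> darts D"
  by (rule next_pow_in) (rule d\<^sub>0)

lemma pass_in_tour: "pass i \<in> tour"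
  by (rule funpow_in_orbit) (rule self_in_passages[OF d\<^sub>0])

lemma pass_inj: "i < len \<Longrightarrow> j < len \<Longrightarrow> pass i = pass j \<longleftrightarrow> i = j"
  using pass_bij by (metis bij_betw_def inj_on_eq_iff lessThan_iff)

lemma tourE:
  assumes "e \<in> tour"
  obtains i where "i < len" and "e = pass i"
proof -
  have "e \<in> pass ` {..<len}"
    using assms pass_bij by (simp only: bij_betw_def)
  with that show ?thesis by blast
qed

text \<open>Of two opposite darts exactly one belongs to the tour.\<close>

lemma vertex_tour:
  assumes "y \<in> vertices D"
  obtains r s where "r < s" and "s < len" and "pass r \<in> y"
    and "pass s = rot D (pass r) \<or> pass s = rot D (rot D (rot D (pass r)))"
    and "\<And>i. i < len \<Longrightarrow> pass i \<in> y \<longleftrightarrow> i = r \<or> i = s"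
proof -
  obtain d where d: "d \<in> darts D" "y = vertex D d"
    using assms by (auto simp: vertices_def)
  have rd: "rot D d \<in> darts D" using d by (simp add: dartD)
  \<comment> \<open>\<open>a\<close> and \<open>b\<close> are the darts along which the tour leaves
    on the two strands at \<open>y\<close>. They are a quarter turn apart, in a direction that
    depends on the crossing.\<close>
  define a where "a = (if d \<in> tour then d else rot D (rot D d))"
  define b where "b = (if rot D d \<in> tour then rot D d else rot D (rot D (rot D d)))"
  have y: "y = {d, rot D d, rot D (rot D d), rot D (rot D (rot D d))}"
    using d vertex_eq[OF fv] by simp
  have ab: "a \<in> tour" "b \<in> tour" and int: "\<And>e. e \<in> tour \<Longrightarrow> e \<in> y \<longleftrightarrow> e = a \<or> e = b"
    using opposite_in_orbit[OF d\<^sub>0 d(1)] opposite_in_orbit[OF d\<^sub>0 rd]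
    unfolding a_def b_def y by (simp_all split: if_splits) blast+
  have quarter: "b = rot D a \<or> b = rot D (rot D (rot D a))"
    "a = rot D b \<or> a = rot D (rot D (rot D b))"
    using d rd by (auto simp: a_def b_def dartD)
  have "a \<noteq> b"
    using quarter orbit_mem_in[OF d\<^sub>0 ab(1)] by (metis dartD(2,3))
  obtain i where i: "i < len" "pass i = a"
    using tourE[OF ab(1)] by metis
  obtain j where j: "j < len" "pass j = b"
    using tourE[OF ab(2)] by metis
  have ij: "k < len \<Longrightarrow> pass k \<in> y \<longleftrightarrow> k = i \<or> k = j" for k
    using int[OF pass_in_tour] pass_inj i j by metis
  have "i \<noteq> j" using i j \<open>a \<noteq> b\<close> by auto
  then consider "i < j" | "j < i" by linarith
  then show ?thesis
  proof cases
    case 1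
    then show ?thesis using that[of i j] i j ij quarter int[OF pass_in_tour] by auto
  next
    case 2
    then show ?thesis using that[of j i] i j ij quarter int[OF pass_in_tour] by auto
  qed
qed

end

section \<open>Alternation of two letters in a word\<close>

lemma subseq_Cons_conv_nth:
  "subseq (a # as) w \<longleftrightarrow> (\<exists>i<length w. w ! i = a \<and> subseq as (drop (Suc i) w))"
proof
  assume "subseq (a # as) w"
  then obtain us vs where w: "w = us @ a # vs" "subseq as vs"
    by (auto dest: list_emb_ConsD)
  then show "\<exists>i<length w. w ! i = a \<and> subseq as (drop (Suc i) w)"
    by (intro exI[of _ "length us"]) auto
next
  assume "\<exists>i<length w. w ! i = a \<and> subseq as (drop (Suc i) w)"
  then obtain i where i: "i < length w" "w ! i = a" "subseq as (drop (Suc i) w)" by blast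
  then have "subseq (a # as) (drop i w)"
    by (simp add: Cons_nth_drop_Suc[symmetric])
  then have "subseq (a # as) (take i w @ drop i w)"
    by (rule list_emb_append2)
  then show "subseq (a # as) w" by simp
qed

lemma subseq4_conv_nth:
  "subseq [a, b, c, d] w \<longleftrightarrow> (\<exists>i j k l. i < j \<and> j < k \<and> k < l \<and> l < length w \<and>
     w ! i = a \<and> w ! j = b \<and> w ! k = c \<and> w ! l = d)" (is "?L \<longleftrightarrow> ?R")
proof
  assume ?L
  then obtain i j k l where "i < length w" "w ! i = a"
    and "j < length (drop (Suc i) w)" "drop (Suc i) w ! j = b"
    and "k < length (drop (Suc j) (drop (Suc i) w))" "drop (Suc j) (drop (Suc i) w) ! k = c"
    and "l < length (drop (Suc k) (drop (Suc j) (drop (Suc i) w)))"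
      "drop (Suc k) (drop (Suc j) (drop (Suc i) w)) ! l = d"
    unfolding subseq_Cons_conv_nth by blast
  then show ?R
    by (intro exI[of _ i] exI[of _ "Suc i + j"] exI[of _ "Suc i + Suc j + k"]
        exI[of _ "Suc i + Suc j + Suc k + l"]) (auto simp: add_ac)
next
  assume ?R
  then obtain i j k l where *: "i < j" "j < k" "k < l" "l < length w"
    "w ! i = a" "w ! j = b" "w ! k = c" "w ! l = d" by blast
  have "subseq [d] (drop (Suc k) w)"
    unfolding subseq_Cons_conv_nth[of d] using * by (intro exI[of _ "l - Suc k"]) simp
  then have "subseq [c, d] (drop (Suc j) w)"
    unfolding subseq_Cons_conv_nth[of c] using * by (intro exI[of _ "k - Suc j"]) simp
  then have "subseq [b, c, d] (drop (Suc i) w)"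
    unfolding subseq_Cons_conv_nth[of b] using * by (intro exI[of _ "j - Suc i"]) simp
  then show ?L
    unfolding subseq_Cons_conv_nth[of a] using * by (intro exI[of _ i]) simp
qed

text \<open>Each letter has just two occurrences, so an alternating subsequence of length four has
  to use all of them, each letter in increasing order.\<close>

lemma alternate_in_conv_positions:
  assumes "\<And>i. i < length w \<Longrightarrow> w ! i = x \<longleftrightarrow> i = p \<or> i = q"
    and "\<And>i. i < length w \<Longrightarrow> w ! i = y \<longleftrightarrow> i = r \<or> i = s"
    and "p < q" "q < length w" "r < s" "s < length w"
  shows "alternate_in w x y \<longleftrightarrow> (p < r \<and> r < q \<and> q < s) \<or> (r < p \<and> p < s \<and> s < q)"
proof -
  have "subseq [x, y, x, y] w \<longleftrightarrow> p < r \<and> r < q \<and> q < s"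
  proof
    assume "subseq [x, y, x, y] w"
    then obtain i j k l where "i < j" "j < k" "k < l" "l < length w"
      "w ! i = x" "w ! j = y" "w ! k = x" "w ! l = y" unfolding subseq4_conv_nth by blast
    moreover from this have "i = p \<or> i = q" "j = r \<or> j = s" "k = p \<or> k = q" "l = r \<or> l = s"
      using assms by (metis order.strict_trans)+
    ultimately show "p < r \<and> r < q \<and> q < s" using assms by linarith
  next
    assume "p < r \<and> r < q \<and> q < s"
    then show "subseq [x, y, x, y] w"
      unfolding subseq4_conv_nth
      by (intro exI[of _ p] exI[of _ r] exI[of _ q] exI[of _ s]) (use assms in auto)
  qed
  moreover have "subseq [y, x, y, x] w \<longleftrightarrow> r < p \<and> p < s \<and> s < q"
  proof
    assume "subseq [y, x, y, x] w"
    then obtain i j k l where "i < j" "j < k" "k < l" "l < length w"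
      "w ! i = y" "w ! j = x" "w ! k = y" "w ! l = x" unfolding subseq4_conv_nth by blast
    moreover from this have "i = r \<or> i = s" "j = p \<or> j = q" "k = r \<or> k = s" "l = p \<or> l = q"
      using assms by (metis order.strict_trans)+
    ultimately show "r < p \<and> p < s \<and> s < q" using assms by linarith
  next
    assume "r < p \<and> p < s \<and> s < q"
    then show "subseq [y, x, y, x] w"
      unfolding subseq4_conv_nth
      by (intro exI[of _ r] exI[of _ p] exI[of _ s] exI[of _ q]) (use assms in auto)
  qed
  ultimately show ?thesis by (simp add: alternate_in_def)
qed

section \<open>The Gauss word and the colour changes along a traversal\<close>

context knot_tour
begin

lemma gauss_word_positions:
  assumes "y \<in> vertices D" and "i < len"
  shows "gauss_word D d\<^sub>0 ! i = y \<longleftrightarrow> pass i \<in> y"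
  using assms pass_in by (simp add: gauss_word_def mem_vertex_iff[OF fv])

lemma length_gauss_word: "length (gauss_word D d\<^sub>0) = len"
  by (simp add: gauss_word_def)

lemma halving_pass:
  assumes "halving D x \<phi>" and "x \<in> vertices D"
  shows "\<phi> (pass (Suc i)) = \<phi> (pass i) \<longleftrightarrow> pass (Suc i) \<notin> x"
proof -
  define e where "e = pass i"
  have e: "e \<in> darts D" and te: "twin D e \<in> darts D"
    using pass_in dartD(4) by (auto simp: e_def)
  have "rot D (rot D (twin D e)) \<in> x \<longleftrightarrow> twin D e \<in> x"
    using rot_mem_vertex[OF fv assms(2)] te dartD(1) by metis
  moreover have "\<phi> (twin D e) = \<phi> e"
    using assms e by (simp add: halving_def)
  moreover have "\<phi> (rot D (rot D (twin D e))) = \<phi> (twin D e) \<longleftrightarrow> twin D e \<notin> x"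
    using assms te by (simp add: halving_def)
  ultimately show ?thesis
    by (simp add: next_passage_def flip: e_def)
qed

text \<open>The colour along the tour changes exactly at the two visits \<open>p\<close> and
  \<open>q\<close> of \<open>x\<close>, so it tells apart the two arcs between them. The visits
  \<open>r\<close> and \<open>s\<close> of \<open>y\<close> are interlaced with these iff they lie
  on different arcs, and a quarter turn at \<open>y\<close> leads from one strand to the
  other.\<close>

lemma alternate_iff_bend:
  assumes \<phi>: "halving D x \<phi>" and x: "x \<in> vertices D" and y: "y \<in> vertices D" "x \<noteq> y"
    and d: "d \<in> y"
  shows "alternate_in (gauss_word D d\<^sub>0) x y \<longleftrightarrow> \<phi> (rot D d) \<noteq> \<phi> d"
proof -
  obtain p q where pq: "p < q" "q < len" "\<And>i. i < len \<Longrightarrow> pass i \<in> x \<longleftrightarrow> i = p \<or> i = q"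
    by (rule vertex_tour[OF x]) blast
  obtain r s where rs: "r < s" "s < len" "pass r \<in> y"
    "pass s = rot D (pass r) \<or> pass s = rot D (rot D (rot D (pass r)))"
    and rs_y: "\<And>i. i < len \<Longrightarrow> pass i \<in> y \<longleftrightarrow> i = r \<or> i = s"
    by (rule vertex_tour[OF y(1)]) blast
  have disj: "e \<notin> x" if "e \<in> y" for e
    using that vertex_of_mem[OF fv] x y by metis
  have in_y: "rot D e \<in> y \<and> e \<in> darts D" if "e \<in> y" for e
    using that rot_mem_vertex[OF fv y(1)] vertices_subset[OF fv y(1)] by blast
  have opp: "\<phi> (rot D (rot D e)) = \<phi> e" if "e \<in> y" for e
    using \<phi> that disj in_y by (auto simp: halving_def)
  have neq: "p \<noteq> r" "p \<noteq> s" "q \<noteq> r" "q \<noteq> s"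
    using pq(3)[of r] pq(3)[of s] rs_y[of r] rs_y[of s] rs disj by auto
  \<comment> \<open>Position 0 is the reference. It lies in the arc from \<open>p\<close> to
    \<open>q\<close> iff \<open>p \<le> 0\<close>, since \<open>0 < q\<close>. The arc is half-open
    because \<open>pass p\<close> leaves \<open>x\<close> and already has the new colour.\<close>
  have col: "i < len \<Longrightarrow> \<phi> (pass i) = (\<phi> (pass 0) = ((p \<le> i \<and> i < q) = (p \<le> 0)))" for i
  proof (induct i)
    case 0 show ?case using pq by auto
  next
    case (Suc i)
    then show ?case using halving_pass[OF \<phi> x, of i] pq(3)[of "Suc i"] pq(1)
      by (auto simp: le_Suc_eq less_Suc_eq)
  qed
  have "d \<in> vertex D (pass r)"
    using vertex_of_mem[OF fv y(1) rs(3)] d by simp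
  then have "d \<in> {pass r, rot D (pass r), rot D (rot D (pass r)), rot D (rot D (rot D (pass r)))}"
    using vertex_eq[OF fv pass_in] by simp
  then have "\<phi> (rot D d) \<noteq> \<phi> d \<longleftrightarrow> \<phi> (rot D (pass r)) \<noteq> \<phi> (pass r)"
    using opp[of "pass r"] opp[of "rot D (pass r)"] rs(3) in_y pass_in dartD(2) by auto
  also have "\<dots> \<longleftrightarrow> \<phi> (pass s) \<noteq> \<phi> (pass r)"
    using rs(3,4) opp[of "rot D (pass r)"] in_y by auto
  also have "\<dots> \<longleftrightarrow> (p \<le> r \<and> r < q) \<noteq> (p \<le> s \<and> s < q)"
    using col[of r] col[of s] rs by auto
  also have "\<dots> \<longleftrightarrow> (p < r \<and> r < q \<and> q < s) \<or> (r < p \<and> p < s \<and> s < q)"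
    using neq rs(1) pq(1) by auto
  also have "\<dots> \<longleftrightarrow> alternate_in (gauss_word D d\<^sub>0) x y"
    by (rule alternate_in_conv_positions[symmetric])
      (use pq rs rs_y x y in \<open>auto simp: length_gauss_word gauss_word_positions\<close>)
  finally show ?thesis by blast
qed

end

section \<open>Adjacency as a bend, and existence of halvings\<close>

context knot
begin

lemma adj_LG_iff_bend:
  assumes "halving D x \<phi>" and "x \<in> vertices D" and "y \<in> vertices D" and "x \<noteq> y" and "d \<in> y"
  shows "adj (LG D) x y \<longleftrightarrow> \<phi> (rot D d) \<noteq> \<phi> d"
proof -
  have "alternate_in (gauss_word D e) x y \<longleftrightarrow> \<phi> (rot D d) \<noteq> \<phi> d" if "e \<in> darts D" for e
  proof -
    interpret knot_tour D e by unfold_locales (rule that)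
    show ?thesis by (rule alternate_iff_bend) (fact assms)+
  qed
  moreover have "d \<in> darts D"
    using assms vertices_subset[OF fv] by blast
  ultimately show ?thesis
    using assms by (auto simp: LG_def)
qed

text \<open>If the tour starts at \<open>x\<close>, its second visit \<open>q\<close> cuts it into
  two arcs, which serve as the colours. A dart off the tour takes the colour of the other dart of
  its edge.\<close>

lemma ex_halving:
  assumes "x \<in> vertices D"
  obtains \<phi> where "halving D x \<phi>"
proof -
  obtain d where d: "d \<in> darts D" "x = vertex D d"
    using assms by (auto simp: vertices_def)
  interpret knot_tour D d by unfold_locales (rule d)
  have "pass 0 \<in> x" using d self_in_vertex[OF fv] by simp
  obtain p q where "p < q" "q < len" "\<And>i. i < len \<Longrightarrow> pass i \<in> x \<longleftrightarrow> i = p \<or> i = q"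
    by (rule vertex_tour[OF assms]) blast
  with \<open>pass 0 \<in> x\<close> have q: "0 < q" "q < len" "\<And>i. i < len \<Longrightarrow> pass i \<in> x \<longleftrightarrow> i = 0 \<or> i = q"
    by (metis bot_nat_0.extremum_strict gr0I order.strict_trans)+
  define idx where "idx = the_inv_into {..<len} pass"
  have idx: "idx (pass i) = i" if "i < len" for i
    using the_inv_into_f_f[OF bij_betw_imp_inj_on[OF pass_bij]] that by (simp add: idx_def)
  define \<phi> where "\<phi> e \<longleftrightarrow> idx (if e \<in> tour then e else twin D e) < q" for e
  have on_tour: "(\<phi> (rot D (rot D e)) \<longleftrightarrow> \<phi> e) \<longleftrightarrow> e \<notin> x" if e: "e \<in> tour" for e
  proof -
    have e_in: "e \<in> darts D" using e d orbit_mem_in by blast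
    \<comment> \<open>The dart opposite to \<open>e\<close> is off the tour; its edge is that of the
      preceding passage, whose index therefore decides its colour.\<close>
    then have \<phi>_opp: "\<phi> (rot D (rot D e)) \<longleftrightarrow> idx (twin D (rot D (rot D e))) < q"
      using e opposite_in_orbit[OF d(1)] by (simp add: \<phi>_def)
    obtain i where i: "i < len" "e = pass i"
      using tourE[OF e] by metis
    show ?thesis
    proof (cases i)
      case 0
      \<comment> \<open>The tour closes up here: \<open>pass 0\<close> is preceded by the last
        passage, which lies on the second arc because \<open>q \<le> len - 1\<close>.\<close>
      have "pass len = \<sigma> (pass (len - 1))"
        using q by (cases len) auto
      then have "twin D (rot D (rot D e)) = pass (len - 1)"
        using prev_next[OF pass_in, of "len - 1"] pass_len i 0 by simp
      then show ?thesis
        using \<phi>_opp idx[of "len - 1"] idx[of 0] i 0 e q \<open>pass 0 \<in> x\<close> by (auto simp: \<phi>_def)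
    next
      case (Suc j)
      then have "twin D (rot D (rot D e)) = pass j"
        using prev_next[OF pass_in, of j] i by simp
      then show ?thesis
        using \<phi>_opp idx[of j] idx[of i] i Suc e q(3)[of i] by (auto simp: \<phi>_def)
    qed
  qed
  have "halving D x \<phi>"
    unfolding halving_def
  proof (intro ballI conjI)
    fix e assume e: "e \<in> darts D"
    show "\<phi> (twin D e) \<longleftrightarrow> \<phi> e"
      using twin_in_orbit[OF d(1) e] e by (auto simp: \<phi>_def dartD)
    show "(\<phi> (rot D (rot D e)) \<longleftrightarrow> \<phi> e) \<longleftrightarrow> e \<notin> x"
    proof (cases "e \<in> tour")
      case False
      then have "rot D (rot D e) \<in> tour"
        using opposite_in_orbit[OF d(1) e] by simp
      from on_tour[OF this] e show ?thesis
        using rot_mem_vertex[OF fv assms] dartD(1,2) by metis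
    qed (rule on_tour)
  qed
  then show ?thesis by (rule that)
qed

end

text \<open>\<open>k\<close> respects crossings, but need not commute with \<open>rot\<close> or
  \<open>twin\<close>. Bends are compared instead of colours, since colours may be exchanged inside
  a tangle. The darts of \<open>x\<close> are left out: opposite darts differ in colour there, so a
  reflection, which inverts \<open>rot\<close>, would reverse the comparison.\<close>

definition halving_map :: "('a, 'm) projection_scheme \<Rightarrow> ('b, 'n) projection_scheme \<Rightarrow> ('a \<Rightarrow> 'b) \<Rightarrow> bool" where
  "halving_map M M' k \<longleftrightarrow> bij_betw k (darts M) (darts M') \<and>
     (\<forall>d\<in>darts M. k ` vertex M d = vertex M' (k d)) \<and>
     (\<forall>x\<in>vertices M. \<forall>\<phi>. halving M x \<phi> \<longrightarrow> (\<exists>\<phi>'. halving M' (k ` x) \<phi>' \<and>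
        (\<forall>d\<in>darts M - x. (\<phi>' (rot M' (k d)) \<longleftrightarrow> \<phi>' (k d)) \<longleftrightarrow> (\<phi> (rot M d) \<longleftrightarrow> \<phi> d))))"

lemma halving_map_halving:
  assumes "halving_map M M' k" and "x \<in> vertices M" and "halving M x \<phi>"
  obtains \<phi>' where "halving M' (k ` x) \<phi>'"
    and "\<And>d. d \<in> darts M \<Longrightarrow> d \<notin> x \<Longrightarrow>
      (\<phi>' (rot M' (k d)) \<longleftrightarrow> \<phi>' (k d)) \<longleftrightarrow> (\<phi> (rot M d) \<longleftrightarrow> \<phi> d)"
proof -
  have "\<exists>\<phi>'. halving M' (k ` x) \<phi>' \<and>
      (\<forall>d\<in>darts M - x. (\<phi>' (rot M' (k d)) \<longleftrightarrow> \<phi>' (k d)) \<longleftrightarrow> (\<phi> (rot M d) \<longleftrightarrow> \<phi> d))"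
    using assms by (simp only: halving_map_def)
  then show ?thesis by (elim exE conjE) (rule that, auto)
qed

lemma halving_map_vertices:
  assumes "halving_map M M' k"
  shows "(`) k ` vertices M = vertices M'"
proof -
  have "(`) k ` vertices M = (\<lambda>d. vertex M' (k d)) ` darts M"
    using assms by (simp add: halving_map_def vertices_def image_image)
  also have "\<dots> = vertex M' ` k ` darts M"
    by (simp add: image_image)
  also have "k ` darts M = darts M'"
    using assms by (simp add: halving_map_def bij_betw_def)
  finally show ?thesis by (simp add: vertices_def)
qed

lemma halving_map_trans:
  assumes fv: "four_valent M" and k: "halving_map M M' k" and l: "halving_map M' M'' l"
  shows "halving_map M M'' (l \<circ> k)"
  unfolding halving_map_def
proof (intro conjI ballI allI impI)
  have bij: "bij_betw k (darts M) (darts M')" "bij_betw l (darts M') (darts M'')"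
    using k l by (simp_all add: halving_map_def)
  then show "bij_betw (l \<circ> k) (darts M) (darts M'')"
    by (rule bij_betw_trans)
  have k_in: "k d \<in> darts M'" if "d \<in> darts M" for d
    using that bij by (meson bij_betwE)
  show "(l \<circ> k) ` vertex M d = vertex M'' ((l \<circ> k) d)" if "d \<in> darts M" for d
  proof -
    have "(l \<circ> k) ` vertex M d = l ` vertex M' (k d)"
      using k that unfolding halving_map_def image_comp[symmetric] by metis
    then show ?thesis
      using l k_in[OF that] by (simp add: halving_map_def)
  qed
  fix x \<phi>
  assume x: "x \<in> vertices M" and \<phi>: "halving M x \<phi>"
  obtain \<phi>' where \<phi>': "halving M' (k ` x) \<phi>'"
    "\<And>d. d \<in> darts M \<Longrightarrow> d \<notin> x \<Longrightarrow>
       (\<phi>' (rot M' (k d)) \<longleftrightarrow> \<phi>' (k d)) \<longleftrightarrow> (\<phi> (rot M d) \<longleftrightarrow> \<phi> d)"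
    using halving_map_halving[OF k x \<phi>] by metis
  have "k ` x \<in> vertices M'"
    using halving_map_vertices[OF k] x by blast
  then obtain \<phi>'' where \<phi>'': "halving M'' (l ` k ` x) \<phi>''"
    "\<And>d. d \<in> darts M' \<Longrightarrow> d \<notin> k ` x \<Longrightarrow>
       (\<phi>'' (rot M'' (l d)) \<longleftrightarrow> \<phi>'' (l d)) \<longleftrightarrow> (\<phi>' (rot M' d) \<longleftrightarrow> \<phi>' d)"
    using halving_map_halving[OF l _ \<phi>'(1)] by metis
  have "k d \<notin> k ` x" if "d \<in> darts M" "d \<notin> x" for d
    using that vertices_subset[OF fv x] inj_on_image_mem_iff[OF bij_betw_imp_inj_on[OF bij(1)]]
    by blast
  with k_in \<phi>' \<phi>'' show "\<exists>\<phi>'. halving M'' ((l \<circ> k) ` x) \<phi>' \<and> (\<forall>d\<in>darts M - x.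
      (\<phi>' (rot M'' ((l \<circ> k) d)) \<longleftrightarrow> \<phi>' ((l \<circ> k) d)) \<longleftrightarrow> (\<phi> (rot M d) \<longleftrightarrow> \<phi> d))"
    by (intro exI[of _ \<phi>'']) (simp add: image_comp[symmetric] del: o_apply, simp)
qed

text \<open>\<open>adj_LG_iff_bend\<close> accepts any halving, so the transported one computes
  adjacency in \<open>D'\<close>.\<close>

lemma graph_iso_LG:
  assumes D: "knot_diagram D" and D': "knot_diagram D'" and k: "halving_map D D' k"
  shows "graph_iso (LG D) (LG D')"
proof -
  interpret D: knot D by unfold_locales (rule D)
  interpret D': knot D' by unfold_locales (rule D')
  have inj: "inj_on k (darts D)" and onto: "k ` darts D = darts D'"
    using k by (auto simp: halving_map_def bij_betw_def)
  have "inj_on ((`) k) (vertices D)"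
    by (rule inj_onI) (metis D.fv inj inj_on_image_eq_iff vertices_subset)
  then have bij: "bij_betw ((`) k) (vertices D) (vertices D')"
    using halving_map_vertices[OF k] by (simp add: bij_betw_def)
  have adj: "adj (LG D') (k ` x) (k ` y) \<longleftrightarrow> adj (LG D) x y"
    if x: "x \<in> vertices D" and y: "y \<in> vertices D" for x y
  proof (cases "x = y")
    case True
    then show ?thesis by (simp add: LG_def)
  next
    case False
    obtain \<phi> where \<phi>: "halving D x \<phi>"
      using x by (rule D.ex_halving)
    then obtain \<phi>' where \<phi>': "halving D' (k ` x) \<phi>'"
      "\<And>d. d \<in> darts D \<Longrightarrow> d \<notin> x \<Longrightarrow>
         (\<phi>' (rot D' (k d)) \<longleftrightarrow> \<phi>' (k d)) \<longleftrightarrow> (\<phi> (rot D d) \<longleftrightarrow> \<phi> d)"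
      using halving_map_halving[OF k x] by metis
    obtain d where d: "d \<in> darts D" "y = vertex D d"
      using y by (auto simp: vertices_def)
    then have "d \<in> y" using self_in_vertex[OF D.fv] by simp
    moreover from this have "d \<notin> x"
      using False vertex_of_mem[OF D.fv] x y by metis
    moreover have "k ` x \<in> vertices D'" "k ` y \<in> vertices D'" "k ` x \<noteq> k ` y"
      using bij x y False by (auto simp: bij_betw_def inj_on_eq_iff)
    ultimately show ?thesis
      using D.adj_LG_iff_bend[OF \<phi> x y False, of d] D'.adj_LG_iff_bend[OF \<phi>'(1), of "k ` y" "k d"]
        \<phi>'(2)[of d] d(1) by blast
  qed
  show ?thesis
    unfolding graph_iso_def using bij adj by (intro exI[of _ "(`) k"]) (simp add: LG_def)
qed

text \<open>This is what transport along a diagram isomorphism requires, and \<open>fill\<close>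
  satisfies it without a proof that the filled map is four-valent.\<close>

definition closed_map :: "('d, 'm) projection_scheme \<Rightarrow> bool" where
  "closed_map M \<longleftrightarrow> (\<forall>d\<in>darts M. rot M d \<in> darts M \<and> twin M d \<in> darts M)"

lemma four_valent_closed: "four_valent M \<Longrightarrow> closed_map M"
  by (simp add: closed_map_def four_valentD)

lemma diagram_iso_sym:
  assumes "diagram_iso D D'" and "closed_map D"
  shows "diagram_iso D' D"
proof -
  obtain h where h: "bij_betw h (darts D) (darts D')" "\<And>d. d \<in> darts D \<Longrightarrow>
      h (rot D d) = rot D' (h d) \<and> h (twin D d) = twin D' (h d) \<and> (h d \<in> over D' \<longleftrightarrow> d \<in> over D)"
    using assms(1) by (auto simp: diagram_iso_def)
  let ?k = "inv_into (darts D) h"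
  have k: "?k (h d) = d" if "d \<in> darts D" for d
    using that h(1) by (simp add: bij_betw_def)
  have "?k (rot D' (h d)) = rot D d \<and> ?k (twin D' (h d)) = twin D d" if "d \<in> darts D" for d
    using that h(2) k assms(2) unfolding closed_map_def by metis
  moreover have "darts D' = h ` darts D"
    using h(1) by (simp add: bij_betw_def)
  ultimately show ?thesis
    unfolding diagram_iso_def using h k
    by (intro exI[of _ ?k]) (auto simp: bij_betw_inv_into)
qed

lemma diagram_iso_halving_map:
  assumes "diagram_iso D D'" and "closed_map D"
  obtains k where "halving_map D D' k"
proof -
  obtain h where h: "bij_betw h (darts D) (darts D')" and
    conj: "\<And>d. d \<in> darts D \<Longrightarrow> h (rot D d) = rot D' (h d) \<and> h (twin D d) = twin D' (h d)"
    using assms(1) by (auto simp: diagram_iso_def)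
  have closed: "rot D d \<in> darts D" "twin D d \<in> darts D" if "d \<in> darts D" for d
    using that assms(2) by (auto simp: closed_map_def)
  let ?k = "inv_into (darts D) h"
  have k: "?k (h d) = d" if "d \<in> darts D" for d
    using that h by (simp add: bij_betw_def)
  have k_rot: "?k (rot D' (h d)) = rot D d" "?k (twin D' (h d)) = twin D d"
      "?k (rot D' (rot D' (h d))) = rot D (rot D d)" if "d \<in> darts D" for d
    using that conj closed k by metis+
  have onto: "darts D' = h ` darts D"
    using h by (simp add: bij_betw_def)
  have vertex: "h ` vertex D d = vertex D' (h d)" if "d \<in> darts D" for d
    unfolding vertex_def by (rule orbit_image_conj[of d "darts D"]) (use that conj closed in auto)
  have sub: "x \<subseteq> darts D" if x: "x \<in> vertices D" for x
  proof
    obtain d where "d \<in> darts D" "x = vertex D d" using x by (auto simp: vertices_def)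
    moreover fix e assume "e \<in> x"
    ultimately have "e \<in> orbit (rot D) d" by (simp add: vertex_def)
    then show "e \<in> darts D" by induct (use \<open>d \<in> darts D\<close> closed in auto)
  qed
  have "halving D' (h ` x) (\<phi> \<circ> ?k)" if "x \<in> vertices D" "halving D x \<phi>" for x \<phi>
    using that inj_on_image_mem_iff[OF bij_betw_imp_inj_on[OF h] _ sub[OF that(1)]]
    by (simp add: halving_def onto k k_rot)
  then have "halving_map D D' h"
    unfolding halving_map_def using h vertex
    by (intro conjI ballI allI impI exI[of _ "_ \<circ> ?k"]) (simp_all add: k k_rot)
  then show ?thesis by (rule that)
qed

section \<open>Filling a projection with tangles\<close>

lemma UNIV_corner: "UNIV = {NW, NE, SE, SW}"
  using corner.exhaust by blast

lemma four_valent_distinct: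
  assumes "four_valent M" and "d \<in> darts M"
  shows "distinct [d, rot M d, rot M (rot M d), rot M (rot M (rot M d))]"
proof -
  note r = four_valentD[OF assms(1)]
  have "rot M d \<noteq> d" "rot M (rot M d) \<noteq> d" "rot M (rot M (rot M d)) \<noteq> d" if "d \<in> darts M" for d
    using that r by metis+
  then show ?thesis using assms(2) r by (simp; metis)
qed

lemma tangle_four_valent: "tangle T \<Longrightarrow> four_valent T"
  by (simp add: tangle_def spherical_def)

lemma tangle_stub:
  assumes "tangle T"
  shows "stub T NW \<in> darts T" and "stub T NE = rot T (stub T NW)"
    and "stub T SE = rot T (rot T (stub T NW))" and "stub T SW = rot T (rot T (rot T (stub T NW)))"
  using assms by (simp_all add: tangle_def)

lemma range_stub: "tangle T \<Longrightarrow> range (stub T) = vertex T (stub T NW)"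
  by (simp add: UNIV_corner tangle_stub vertex_eq[OF tangle_four_valent])

lemma stub_in: "tangle T \<Longrightarrow> stub T c \<in> darts T"
  using range_stub[of T] vertex_subset[OF tangle_four_valent tangle_stub(1), of T] by auto

lemma inj_stub:
  assumes "tangle T"
  shows "inj (stub T)"
proof (rule injI)
  fix c c' assume "stub T c = stub T c'"
  then show "c = c'"
    using four_valent_distinct[OF tangle_four_valent tangle_stub(1), OF assms assms]
    by (cases c; cases c') (auto simp: tangle_stub(2-4)[OF assms])
qed

lemma rot_inner:
  assumes "tangle T" and "d \<in> inner T"
  shows "rot T d \<in> inner T"
  using assms rot_mem_vertex[OF tangle_four_valent, of T "range (stub T)" d]
  by (auto simp: inner_def range_stub vertices_def tangle_stub dest: four_valentD(1)[OF tangle_four_valent])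

lemma inner_subset: "inner T \<subseteq> darts T"
  by (auto simp: inner_def)

lemma not_inner_stub: "stub T c \<notin> inner T"
  by (auto simp: inner_def)

lemma dart_cases:
  assumes "d \<in> darts T"
  obtains "d \<in> inner T" | c where "d = stub T c"
  using assms by (auto simp: inner_def)

lemma corner_dart_simps:
  "corner_dart M f NW = f" "corner_dart M f SW = rot M f"
  "corner_dart M f SE = rot M (rot M f)" "corner_dart M f NE = rot M (rot M (rot M f))"
  by (simp_all add: corner_dart_def numeral_eq_Suc)

locale filling =
  fixes TK :: "('a, 'm) projection_scheme" and F :: "'a set" and T :: "'a \<Rightarrow> 'b tangle"
  assumes TK: "four_valent TK" and frame: "frame TK F"
    and tangle: "\<And>f. f \<in> F \<Longrightarrow> tangle (T f)"
    and no_free: "no_free_circle TK F T"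
begin

text \<open>The gluing pattern of the corners depends on \<open>TK\<close> and \<open>F\<close>
  alone. The same relation therefore serves the filling before and after a mutation.\<close>

definition joined :: "'a \<Rightarrow> corner \<Rightarrow> 'a \<Rightarrow> corner \<Rightarrow> bool" where
  "joined f c g c' \<longleftrightarrow> f \<in> F \<and> g \<in> F \<and> twin TK (corner_dart TK f c) = corner_dart TK g c'"

lemma F_in: "f \<in> F \<Longrightarrow> f \<in> darts TK"
  using frame by (auto simp: frame_def)

lemma corner_dart_vertex: "f \<in> F \<Longrightarrow> corner_dart TK f c \<in> vertex TK f"
  by (cases c) (simp_all add: corner_dart_simps vertex_eq[OF TK F_in])

lemma corner_dart_in: "f \<in> F \<Longrightarrow> corner_dart TK f c \<in> darts TK"
  using corner_dart_vertex vertex_subset[OF TK F_in] by blast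

lemma corner_dart_inj:
  assumes "f \<in> F" and "g \<in> F" and eq: "corner_dart TK f c = corner_dart TK g c'"
  shows "f = g \<and> c = c'"
proof -
  have "vertex TK f = vertex TK g"
    using assms corner_dart_vertex vertex_eqI[OF TK F_in] by metis
  then have "f = g"
    using frame assms self_in_vertex[OF TK F_in] F_in unfolding frame_def by metis
  moreover have "c = c'"
    using eq four_valent_distinct[OF TK F_in[OF assms(1)]] \<open>f = g\<close>
    by (cases c; cases c') (auto simp: corner_dart_simps)
  ultimately show ?thesis by simp
qed

lemma joined_sym: "joined f c g c' \<Longrightarrow> joined g c' f c"
  using four_valentD(5)[OF TK corner_dart_in] unfolding joined_def by metis

lemma joined_unique: "joined f c g c' \<Longrightarrow> joined f c h c'' \<Longrightarrow> g = h \<and> c' = c''"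
  using corner_dart_inj unfolding joined_def by metis

lemma ex_joined:
  assumes "f \<in> F"
  obtains g c' where "joined f c g c'"
proof -
  let ?d = "twin TK (corner_dart TK f c)"
  have d: "?d \<in> darts TK"
    using corner_dart_in[OF assms] by (rule four_valentD(4)[OF TK])
  then obtain g where g: "g \<in> F" "g \<in> vertex TK ?d"
    using frame unfolding frame_def by blast
  then have "?d \<in> vertex TK g"
    using vertex_eqI[OF TK d] self_in_vertex[OF TK d] by metis
  then have "\<exists>c'. ?d = corner_dart TK g c'"
    using vertex_eq[OF TK F_in[OF g(1)]] corner_dart_simps[of TK g] by (metis empty_iff insert_iff)
  with that assms g(1) show ?thesis by (auto simp: joined_def)
qed

section \<open>Strands that run through several tangles\<close>

lemma strand_cross:
  "strand TK F T x (f, stub (T f) c) \<Longrightarrow> joined f c g c' \<Longrightarrow>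
     strand TK F T x (g, twin (T g) (stub (T g) c'))"
  by (auto simp: joined_def intro: strand.pass)

text \<open>\<open>strand\<close> grows at its far end; comparing or concatenating strands also
  requires taking off the first step.\<close>

lemma strand_first_step:
  assumes "strand TK F T x z"
  shows "z = (fst x, twin (T (fst x)) (snd x)) \<or>
    (\<exists>f c g c'. (fst x, twin (T (fst x)) (snd x)) = (f, stub (T f) c) \<and> joined f c g c' \<and>
       strand TK F T (g, stub (T g) c') z)"
  using assms
proof induct
  case (start f d)
  then show ?case by simp
next
  case (pass x f c g c')
  have j: "joined f c g c'" using pass(3-5) by (simp add: joined_def)
  from pass(2) show ?case
  proof (elim disjE exE conjE)
    assume "(f, stub (T f) c) = (fst x, twin (T (fst x)) (snd x))"
    then show ?thesis using j strand.start by metis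
  next
    fix f1 c1 g1 c1'
    assume "(fst x, twin (T (fst x)) (snd x)) = (f1, stub (T f1) c1)" and "joined f1 c1 g1 c1'"
      and "strand TK F T (g1, stub (T g1) c1') (f, stub (T f) c)"
    then show ?thesis using strand_cross[OF _ j] by blast
  qed
qed

lemma strand_append:
  assumes "strand TK F T y z" and "y = (g, stub (T g) c')"
    and "joined f c g c'" and "strand TK F T x (f, stub (T f) c)"
  shows "strand TK F T x z"
  using assms
proof (induct)
  case (start h d)
  then show ?case using strand_cross by auto
next
  case (pass y f1 c1 g1 c1')
  then show ?case using strand.pass by metis
qed

lemma strand_sym:
  assumes "strand TK F T x y" and "fst x \<in> F" and "snd x \<in> darts (T (fst x))"
  shows "strand TK F T y x"
  using assms
proof induct
  case (start f d)
  then show ?case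
    using strand.start[of TK F T f "twin (T f) d"]
    by (simp add: four_valentD(5)[OF tangle_four_valent[OF tangle]])
next
  case (pass x f c g c')
  have "joined g c' f c" by (rule joined_sym) (use pass(3-5) in \<open>simp add: joined_def\<close>)
  moreover have "strand TK F T (g, twin (T g) (stub (T g) c')) (g, stub (T g) c')"
    using strand.start[of TK F T g "twin (T g) (stub (T g) c')"] pass(4)
    by (simp add: four_valentD(5)[OF tangle_four_valent[OF tangle]] stub_in[OF tangle])
  ultimately show ?case
    using strand_append[OF pass(2)[OF pass(6,7)] refl] by blast
qed

lemma fill_dartsD: "x \<in> fill_darts F T \<Longrightarrow> fst x \<in> F \<and> snd x \<in> inner (T (fst x))"
  by (auto simp: fill_darts_def)

text \<open>Strands are deterministic: at a stub there is exactly one way on, and at a dart of a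
  crossing there is none. So a strand from \<open>x\<close> that ends at a crossing runs through
  every other point reached from \<open>x\<close>.\<close>

lemma strand_continue:
  assumes "strand TK F T x y" and "strand TK F T x z" and "z \<in> fill_darts F T"
  shows "z = y \<or> (\<exists>f c g c'. y = (f, stub (T f) c) \<and> joined f c g c' \<and>
    strand TK F T (g, stub (T g) c') z)"
  using assms
proof induct
  case (start f d)
  from strand_first_step[OF start(1)] show ?case by auto
next
  case (pass x f c g c')
  have j: "joined f c g c'" using pass(3-5) by (simp add: joined_def)
  have "z \<noteq> (f, stub (T f) c)" using pass(7) not_inner_stub by (auto simp: fill_darts_def)
  with pass(2)[OF pass(6,7)] obtain f1 c1 g1 c1' where 1: "(f, stub (T f) c) = (f1, stub (T f1) c1)"
    "joined f1 c1 g1 c1'" "strand TK F T (g1, stub (T g1) c1') z" by blast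
  then have "c1 = c" using inj_stub[OF tangle[OF pass(3)]] by (auto dest: injD)
  then have "g1 = g" "c1' = c'" using 1 j joined_unique by blast+
  with strand_first_step[OF 1(3)] show ?case by auto
qed

lemma strand_end_unique:
  assumes "strand TK F T x y" "y \<in> fill_darts F T" and "strand TK F T x z" "z \<in> fill_darts F T"
  shows "y = z"
  using strand_continue[OF assms(1,3,4)] assms(2) not_inner_stub by (auto simp: fill_darts_def)

lemma ex_strand_end:
  assumes "f \<in> F" and "d \<in> darts (T f)"
  obtains y where "y \<in> fill_darts F T" and "strand TK F T (f, d) y"
proof -
  have "twin (T f) d \<in> darts (T f)"
    using assms by (intro four_valentD(4)[OF tangle_four_valent[OF tangle]])
  then show ?thesis
  proof (cases rule: dart_cases)
    case 1
    then show ?thesis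
      using that[OF _ strand.start] assms by (simp add: fill_darts_def)
  next
    case (2 c)
    obtain g c' where j: "joined f c g c'" using ex_joined[OF assms(1)] .
    then obtain y where "y \<in> fill_darts F T" "strand TK F T (g, stub (T g) c') y"
      using no_free unfolding no_free_circle_def joined_def by blast
    then show ?thesis
      using that strand_append[OF _ refl j] strand.start[of TK F T f d] 2 by metis
  qed
qed

lemma twin_fill_eqI:
  assumes "strand TK F T x y" and "y \<in> fill_darts F T"
  shows "twin (fill TK F T) x = y"
  unfolding fill_def using assms by (auto intro!: the_equality intro: strand_end_unique[symmetric])

lemma twin_fill:
  assumes "x \<in> fill_darts F T"
  shows "twin (fill TK F T) x \<in> fill_darts F T" and "strand TK F T x (twin (fill TK F T) x)"
proof -
  obtain y where y: "y \<in> fill_darts F T" "strand TK F T x y"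
    using ex_strand_end[of "fst x" "snd x"] fill_dartsD[OF assms] inner_subset by (metis prod.collapse subsetD)
  with twin_fill_eqI[OF y(2,1)] show "twin (fill TK F T) x \<in> fill_darts F T"
    "strand TK F T x (twin (fill TK F T) x)" by simp_all
qed

lemma darts_fill: "darts (fill TK F T) = fill_darts F T"
  and rot_fill: "rot (fill TK F T) (f, d) = (f, rot (T f) d)"
  by (simp_all add: fill_def)

lemma closed_fill: "closed_map (fill TK F T)"
  using twin_fill(1) rot_inner[OF tangle]
  by (auto simp: closed_map_def darts_fill rot_fill) (auto simp: fill_darts_def)

text \<open>A local substitute for being constant on the edges of \<open>fill\<close>: the colouring
  is also defined on stubs, and each condition concerns a single edge of a tangle or a single
  gluing.\<close>

definition matched :: "('a \<times> 'b \<Rightarrow> bool) \<Rightarrow> bool" where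
  "matched \<chi> \<longleftrightarrow> (\<forall>f\<in>F. \<forall>d\<in>darts (T f). \<chi> (f, twin (T f) d) \<longleftrightarrow> \<chi> (f, d)) \<and>
     (\<forall>f c g c'. joined f c g c' \<longrightarrow> (\<chi> (f, stub (T f) c) \<longleftrightarrow> \<chi> (g, stub (T g) c')))"

lemma matched_strand:
  assumes "strand TK F T x y" and "matched \<chi>" and "fst x \<in> F" and "snd x \<in> darts (T (fst x))"
  shows "\<chi> y = \<chi> x"
  using assms
proof induct
  case (pass x f c g c')
  from pass(3-5) have "joined f c g c'" by (simp add: joined_def)
  with pass(2-4,6-8) show ?case using stub_in[OF tangle] unfolding matched_def by blast
qed (simp add: matched_def)

lemma matched_twin_fill:
  assumes "matched \<chi>" and "x \<in> fill_darts F T"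
  shows "\<chi> (twin (fill TK F T) x) = \<chi> x"
  by (rule matched_strand[OF twin_fill(2)[OF assms(2)] assms(1)])
    (use fill_dartsD[OF assms(2)] in \<open>auto intro: subsetD[OF inner_subset]\<close>)

text \<open>Converse of \<open>matched_twin_fill\<close>. A stub inherits the colour of the dart at
  which its strand ends. Two glued stubs agree because the reversed strand of one followed by the
  strand of the other is an edge of the filled diagram.\<close>

lemma matched_extension:
  assumes \<phi>: "\<And>x. x \<in> fill_darts F T \<Longrightarrow> \<phi> (twin (fill TK F T) x) = \<phi> x"
  obtains \<chi> where "matched \<chi>" and "\<And>x. x \<in> fill_darts F T \<Longrightarrow> \<chi> x = \<phi> x"
proof -
  define \<chi> where "\<chi> x = (if x \<in> fill_darts F T then \<phi> x
    else \<phi> (SOME y. y \<in> fill_darts F T \<and> strand TK F T x y))" for x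
  have stub_end: "\<chi> (f, stub (T f) c) = \<phi> y"
    if "strand TK F T (f, stub (T f) c) y" "y \<in> fill_darts F T" for f c y
  proof -
    have "(SOME y. y \<in> fill_darts F T \<and> strand TK F T (f, stub (T f) c) y) = y"
      using that by (intro some_equality) (auto intro: strand_end_unique)
    moreover have "(f, stub (T f) c) \<notin> fill_darts F T"
      using not_inner_stub by (auto simp: fill_darts_def)
    ultimately show ?thesis by (simp add: \<chi>_def)
  qed
  have along: "\<phi> y = \<phi> z" if "strand TK F T y z" "y \<in> fill_darts F T" "z \<in> fill_darts F T" for y z
    using \<phi>[OF that(2)] twin_fill_eqI[OF that(1,3)] by simp
  have joined: "\<chi> (f, stub (T f) c) = \<chi> (g, stub (T g) c')" if j: "joined f c g c'" for f c g c'
  proof -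
    have FG: "f \<in> F" "g \<in> F" using j by (auto simp: joined_def)
    obtain y where y: "y \<in> fill_darts F T" "strand TK F T (f, stub (T f) c) y"
      using ex_strand_end[OF FG(1) stub_in[OF tangle[OF FG(1)]]] .
    obtain z where z: "z \<in> fill_darts F T" "strand TK F T (g, stub (T g) c') z"
      using ex_strand_end[OF FG(2) stub_in[OF tangle[OF FG(2)]]] .
    have "strand TK F T y (f, stub (T f) c)"
      using strand_sym[OF y(2)] FG stub_in[OF tangle] by simp
    then have "strand TK F T y z"
      using strand_append[OF z(2) refl j] by blast
    with along y z stub_end show ?thesis by metis
  qed
  have "\<chi> (f, twin (T f) d) = \<chi> (f, d)" if f: "f \<in> F" and d: "d \<in> darts (T f)" for f d
  proof -
    have d': "twin (T f) d \<in> darts (T f)" and dd: "twin (T f) (twin (T f) d) = d"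
      using f d four_valentD[OF tangle_four_valent[OF tangle]] by blast+
    have half: "\<chi> (f, twin (T f) e) = \<chi> (f, e)"
      if e: "e \<in> darts (T f)" "twin (T f) e \<in> inner (T f)" for e
      using e(1)
    proof (cases rule: dart_cases)
      case 1
      then have "(f, e) \<in> fill_darts F T" "(f, twin (T f) e) \<in> fill_darts F T"
        using e f by (auto simp: fill_darts_def)
      with along[OF strand.start] show ?thesis by (simp add: \<chi>_def)
    next
      case (2 c)
      then have "(f, twin (T f) e) \<in> fill_darts F T"
        using e f by (auto simp: fill_darts_def)
      with stub_end[of f c] strand.start[of TK F T f e] 2 show ?thesis by (simp add: \<chi>_def)
    qed
    show ?thesis
    proof (cases "d \<in> inner (T f) \<or> twin (T f) d \<in> inner (T f)")
      case True
      then show ?thesis using half[OF d] half[OF d'] dd by auto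
    next
      case False
      \<comment> \<open>This is a strand without crossings between two corners. What starts at
        \<open>c\<close> leaves the tangle at \<open>c'\<close>, so it ends where the strand from
        the stub glued to \<open>c'\<close> ends.\<close>
      then obtain c c' where c: "d = stub (T f) c" "twin (T f) d = stub (T f) c'"
        using d d' dart_cases by metis
      obtain y where y: "y \<in> fill_darts F T" "strand TK F T (f, d) y"
        using ex_strand_end[OF f d] .
      then obtain f1 c1 g1 c1' where 1: "(f, stub (T f) c') = (f1, stub (T f1) c1)"
        "joined f1 c1 g1 c1'" "strand TK F T (g1, stub (T g1) c1') y"
        using strand_first_step[OF y(2)] c False by (auto simp: fill_darts_def)
      have "\<chi> (f, stub (T f) c') = \<chi> (g1, stub (T g1) c1')"
        using joined[OF 1(2)] 1(1) by (simp only:)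
      also have "\<dots> = \<phi> y" using stub_end[OF 1(3) y(1)] .
      also have "\<dots> = \<chi> (f, stub (T f) c)" using stub_end y c by metis
      finally show ?thesis using c by simp
    qed
  qed
  with joined have "matched \<chi>" by (simp add: matched_def)
  moreover have "\<chi> x = \<phi> x" if "x \<in> fill_darts F T" for x
    using that by (simp add: \<chi>_def)
  ultimately show ?thesis by (rule that)
qed

end

section \<open>Mutations\<close>

lemma even_card_four:
  assumes "distinct [a, b, c, d]"
  shows "even (card {e \<in> {a, b, c, d}. P e}) \<longleftrightarrow> (P a = P b) = (P c = P d)"
proof -
  have "{e \<in> {a, b, c, d}. P e} = set (filter P [a, b, c, d])" by auto
  then have "card {e \<in> {a, b, c, d}. P e} = length (filter P [a, b, c, d])"
    using distinct_card[OF distinct_filter[OF assms], of P] by simp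
  then show ?thesis by simp
qed

text \<open>
  Counting the darts of the colour \<open>True\<close>: edges contribute 0 or 2 of them, inner vertices an
  even number, hence so do the four stubs.
\<close>

lemma even_boundary:
  fixes \<chi> :: "'d \<Rightarrow> bool"
  assumes T: "tangle T" and twin: "\<And>d. d \<in> darts T \<Longrightarrow> \<chi> (twin T d) = \<chi> d"
    and inner: "\<And>d. d \<in> inner T \<Longrightarrow>
      (\<chi> (rot T (rot T d)) = \<chi> d) = (\<chi> (rot T (rot T (rot T d))) = \<chi> (rot T d))"
  shows "(\<chi> (stub T NW) = \<chi> (stub T NE)) = (\<chi> (stub T SE) = \<chi> (stub T SW))"
proof -
  note fv = tangle_four_valent[OF T]
  let ?A = "{d \<in> darts T. \<chi> d}" and ?I = "{d \<in> inner T. \<chi> d}" and ?S = "{d \<in> range (stub T). \<chi> d}"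
  have finite: "finite (darts T)" using fv by (rule four_valent_finite)
  have A: "?A = \<Union> ((\<lambda>d. {d, twin T d}) ` ?A)"
    using four_valentD(4)[OF fv] twin by auto
  have "even (card (\<Union> ((\<lambda>d. {d, twin T d}) ` ?A)))"
  proof (rule dvd_partition)
    show "finite (\<Union> ((\<lambda>d. {d, twin T d}) ` ?A))"
      using finite A by (metis (no_types, lifting) finite_subset mem_Collect_eq subsetI)
    show "\<forall>c\<in>(\<lambda>d. {d, twin T d}) ` ?A. even (card c)"
      using four_valentD(6)[OF fv, THEN not_sym] by (auto simp: card_insert_if)
    have "{d, twin T d} = {e, twin T e}"
      if "d \<in> darts T" "e \<in> darts T" "{d, twin T d} \<inter> {e, twin T e} \<noteq> {}" for d e
    proof -
      have "d = e \<or> d = twin T e \<or> e = twin T d"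
        using that four_valentD(5)[OF fv that(1)] four_valentD(5)[OF fv that(2)] by force
      then show ?thesis
        using four_valentD(5)[OF fv that(1)] four_valentD(5)[OF fv that(2)] by (auto simp: insert_commute)
    qed
    then show "\<forall>c\<in>(\<lambda>d. {d, twin T d}) ` ?A. \<forall>c'\<in>(\<lambda>d. {d, twin T d}) ` ?A. c \<noteq> c' \<longrightarrow> c \<inter> c' = {}"
      by blast
  qed
  then have A_even: "even (card ?A)" using A by simp
  let ?V = "\<lambda>d. {e \<in> vertex T d. \<chi> e}"
  have vertex_inner: "vertex T d \<subseteq> inner T" if "d \<in> inner T" for d
    using that rot_inner[OF T] inner_subset[of T] by (auto simp: vertex_eq[OF fv] subset_iff)
  have I: "?I = \<Union> (?V ` inner T)"
    using vertex_inner self_in_vertex[OF fv] inner_subset[of T] by blast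
  have "even (card (\<Union> (?V ` inner T)))"
  proof (rule dvd_partition)
    show "finite (\<Union> (?V ` inner T))"
      unfolding I[symmetric] by (rule finite_subset[OF _ finite]) (auto simp: inner_def)
    \<comment> \<open>The two strands at a vertex both keep or both change their colour, and either
      way the number of coloured darts is even. This includes the crossing at which the knot is
      cut.\<close>
    have "even (card (?V d))" if d: "d \<in> inner T" for d
    proof -
      have d': "d \<in> darts T" using d by (rule subsetD[OF inner_subset])
      show ?thesis
        unfolding vertex_eq[OF fv d'] even_card_four[OF four_valent_distinct[OF fv d']]
        using inner[OF d] by auto
    qed
    then show "\<forall>c\<in>?V ` inner T. even (card c)" by blast
    have "?V d = ?V d'" if "d \<in> inner T" "d' \<in> inner T" "e \<in> ?V d \<inter> ?V d'" for d d' e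
    proof -
      have "vertex T e = vertex T d" "vertex T e = vertex T d'"
        using that inner_subset[of T] by (auto intro!: vertex_eqI[OF fv])
      then show ?thesis by simp
    qed
    then show "\<forall>c\<in>?V ` inner T. \<forall>c'\<in>?V ` inner T. c \<noteq> c' \<longrightarrow> c \<inter> c' = {}"
      by blast
  qed
  then have I_even: "even (card ?I)" using I by simp
  have "?A = ?I \<union> ?S" "?I \<inter> ?S = {}"
    using stub_in[OF T] by (auto simp: inner_def)
  moreover have "finite ?I" "finite ?S"
    using finite by (auto simp: inner_def UNIV_corner)
  ultimately have "card ?A = card ?I + card ?S"
    by (simp add: card_Un_disjoint)
  with A_even I_even have "even (card ?S)" by simp
  moreover have "range (stub T) = {stub T NW, stub T NE, stub T SE, stub T SW}"
    by (simp add: UNIV_corner)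
  moreover have "distinct [stub T NW, stub T NE, stub T SE, stub T SW]"
    using inj_stub[OF T] by (simp add: inj_eq)
  ultimately show ?thesis
    using even_card_four by metis
qed

section \<open>The effect of the symmetries on a tangle\<close>

lemma act_simps:
  "darts (act g T) = darts T" "twin (act g T) = twin T"
  "stub (act g T) c = stub T (move_corner g c)"
  by (auto simp: act_def)

lemma inner_act: "inner (act g T) = inner T"
proof -
  have "surj (move_corner g)"
    by (rule surjI[of _ "move_corner g"]) (cases g; auto split: corner.splits)
  moreover have "stub (act g T) = stub T \<circ> move_corner g"
    by (auto simp: act_simps)
  ultimately have "range (stub (act g T)) = range (stub T)"
    by (metis image_comp)
  then show ?thesis by (simp add: inner_def act_simps)
qed

lemma act_Ident: "act Ident T = T"
proof -
  have "stub T \<circ> move_corner Ident = stub T" by (simp add: fun_eq_iff)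
  then show ?thesis by (simp add: act_def)
qed

lemma rot_act:
  "rot (act g T) d = rot T d \<or> rot (act g T) d = rot T (rot T (rot T d))"
  by (auto simp: act_def numeral_eq_Suc)

text \<open>A reflection inverts \<open>rot\<close>, but the half turn is its own inverse. Strands
  thus stay straight at crossings, and the colouring of a tangle remains admissible.\<close>

lemma rot_rot_act:
  assumes "tangle T" and "d \<in> darts T"
  shows "rot (act g T) (rot (act g T) d) = rot T (rot T d)"
  using four_valentD(1,2)[OF tangle_four_valent[OF assms(1)]] assms(2)
  by (auto simp: act_def numeral_eq_Suc)

lemma vertex_act:
  assumes "tangle T" and "tangle (act g T)" and "d \<in> darts T"
  shows "vertex (act g T) d = vertex T d"
proof -
  note fv = tangle_four_valent[OF assms(1)] and fv' = tangle_four_valent[OF assms(2)]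
  have d': "d \<in> darts (act g T)" using assms(3) by (simp add: act_simps)
  have "rot (act g T) d \<in> darts T"
    using four_valentD(1)[OF fv' d'] by (simp add: act_simps)
  note rr = rot_rot_act[OF assms(1,3), of g] rot_rot_act[OF assms(1) this, of g]
  have "vertex (act g T) d = {d, rot (act g T) d, rot T (rot T d), rot T (rot T (rot (act g T) d))}"
    unfolding vertex_eq[OF fv' d'] unfolding rr(2) unfolding rr(1) by (rule refl)
  then show ?thesis
    using rot_act[of g T d] four_valentD(2)[OF fv assms(3)]
    unfolding vertex_eq[OF fv assms(3)] by (elim disjE) (simp_all add: insert_commute)
qed

context filling
begin

lemma vertex_fill: "vertex (fill TK F T) (f, d) = Pair f ` vertex (T f) d"
  unfolding vertex_def by (rule orbit_image_conj[of d UNIV, symmetric]) (simp_all add: rot_fill)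

lemma vertices_fillE:
  assumes "x \<in> vertices (fill TK F T)"
  obtains f v where "f \<in> F" and "v \<in> vertices (T f)" and "x = Pair f ` v" and "v \<subseteq> inner (T f)"
proof -
  obtain f d where fd: "f \<in> F" "d \<in> inner (T f)" "x = vertex (fill TK F T) (f, d)"
    using assms by (auto simp: vertices_def darts_fill fill_darts_def)
  have d: "d \<in> darts (T f)" using fd(2) by (rule subsetD[OF inner_subset])
  have "vertex (T f) d \<subseteq> inner (T f)"
    using fd(2) rot_inner[OF tangle[OF fd(1)]]
    by (auto simp: vertex_eq[OF tangle_four_valent[OF tangle[OF fd(1)]] d])
  with that fd d show ?thesis
    by (auto simp: vertex_fill vertices_def)
qed

text \<open>
  \<open>\<epsilon> f\<close> tells whether the colours of the tangle at \<open>f\<close> have to be exchanged in order to fit its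
  new surroundings.
\<close>

lemma halving_map_fill:
  assumes T': "filling TK F T'" and act: "\<And>f. f \<in> F \<Longrightarrow> T' f = act (g f) (T (p f))"
    and pq: "\<And>f. f \<in> F \<Longrightarrow> p f \<in> F \<and> q f \<in> F \<and> p (q f) = f \<and> q (p f) = f"
    and adjust: "\<And>B :: 'a \<Rightarrow> corner \<Rightarrow> bool. (\<And>f. f \<in> F \<Longrightarrow> (B f NW = B f NE) = (B f SE = B f SW)) \<Longrightarrow>
      (\<And>f c h c'. joined f c h c' \<Longrightarrow> B f c = B h c') \<Longrightarrow>
      \<exists>\<epsilon>. \<forall>f c h c'. joined f c h c' \<longrightarrow>
        (B (p f) (move_corner (g f) c) \<noteq> \<epsilon> f) = (B (p h) (move_corner (g h) c') \<noteq> \<epsilon> h)"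
  shows "halving_map (fill TK F T) (fill TK F T') (\<lambda>(f, d). (q f, d))"
proof -
  interpret T': filling TK F T' by (rule T')
  \<comment> \<open>The new tangle at a place \<open>h\<close> comes from \<open>p h\<close>, so the
    one formerly at \<open>f\<close> is now at \<open>q f\<close>. Symmetries keep the names of its
    darts.\<close>
  let ?k = "\<lambda>(f, d). (q f, d)"
  have inner': "inner (T' f) = inner (T (p f))" and darts': "darts (T' f) = darts (T (p f))" if "f \<in> F" for f
    using that by (simp_all add: act inner_act act_simps)
  have bij: "bij_betw ?k (fill_darts F T) (fill_darts F T')"
    by (rule bij_betw_byWitness[where f' = "\<lambda>(f, d). (p f, d)"])
      (auto simp: fill_darts_def pq inner')
  have vertex: "?k ` vertex (fill TK F T) (f, d) = vertex (fill TK F T') (q f, d)"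
    if "(f, d) \<in> fill_darts F T" for f d
  proof -
    have f: "f \<in> F" "d \<in> darts (T f)" using that subsetD[OF inner_subset] by (auto simp: fill_darts_def)
    have "vertex (T' (q f)) d = vertex (T f) d"
      using vertex_act[of "T f" "g (q f)" d] act[of "q f"] T'.tangle[of "q f"] tangle[of f] f pq[of f]
      by simp
    then show ?thesis by (simp add: vertex_fill T'.vertex_fill image_image)
  qed
  have halving: "\<exists>\<phi>'. halving (fill TK F T') (?k ` x) \<phi>' \<and>
      (\<forall>d\<in>darts (fill TK F T) - x. (\<phi>' (rot (fill TK F T') (?k d)) \<longleftrightarrow> \<phi>' (?k d)) \<longleftrightarrow>
        (\<phi> (rot (fill TK F T) d) \<longleftrightarrow> \<phi> d))"
    if x: "x \<in> vertices (fill TK F T)" and \<phi>: "halving (fill TK F T) x \<phi>" for x \<phi>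
  proof -
    obtain f0 v where v: "f0 \<in> F" "v \<in> vertices (T f0)" "x = Pair f0 ` v" "v \<subseteq> inner (T f0)"
      using x by (rule vertices_fillE)
    have mem_x: "(f, d) \<in> x \<longleftrightarrow> f = f0 \<and> d \<in> v" for f d
      using v(3) by auto
    have rot_x: "(f, rot (T f) d) \<in> x \<longleftrightarrow> (f, d) \<in> x" if "f \<in> F" "d \<in> inner (T f)" for f d
      using rot_mem_vertex[OF tangle_four_valent[OF tangle[OF v(1)]] v(2)] that inner_subset[of "T f"]
      by (auto simp: mem_x)
    obtain \<chi> where \<chi>: "matched \<chi>" "\<And>y. y \<in> fill_darts F T \<Longrightarrow> \<chi> y = \<phi> y"
      using matched_extension[of \<phi>] \<phi> unfolding halving_def darts_fill by metis
    have opp: "\<chi> (f, rot (T f) (rot (T f) d)) = \<chi> (f, d) \<longleftrightarrow> (f, d) \<notin> x"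
      if "f \<in> F" "d \<in> inner (T f)" for f d
    proof -
      have "(f, d) \<in> fill_darts F T" "(f, rot (T f) (rot (T f) d)) \<in> fill_darts F T"
        using that rot_inner[OF tangle] by (auto simp: fill_darts_def)
      with \<phi> \<chi>(2) show ?thesis by (auto simp: halving_def darts_fill rot_fill)
    qed
    define B where "B f c = \<chi> (f, stub (T f) c)" for f c
    have B_even: "(B f NW = B f NE) = (B f SE = B f SW)" if f: "f \<in> F" for f
      unfolding B_def
    proof (rule even_boundary[OF tangle[OF f]])
      show "\<chi> (f, twin (T f) d) = \<chi> (f, d)" if "d \<in> darts (T f)" for d
        using that f \<chi>(1) by (simp add: matched_def)
      show "(\<chi> (f, rot (T f) (rot (T f) d)) = \<chi> (f, d)) =
          (\<chi> (f, rot (T f) (rot (T f) (rot (T f) d))) = \<chi> (f, rot (T f) d))" if "d \<in> inner (T f)" for d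
        using that f by (simp add: opp rot_x rot_inner[OF tangle])
    qed
    have B_joined: "B f c = B h c'" if "joined f c h c'" for f c h c'
      using that \<chi>(1) by (simp add: matched_def B_def)
    have "\<exists>\<epsilon>. \<forall>f c h c'. joined f c h c' \<longrightarrow>
        (B (p f) (move_corner (g f) c) \<noteq> \<epsilon> f) = (B (p h) (move_corner (g h) c') \<noteq> \<epsilon> h)"
      by (rule adjust) (erule B_even, erule B_joined)
    then obtain \<epsilon> where \<epsilon>: "\<forall>f c h c'. joined f c h c' \<longrightarrow>
        (B (p f) (move_corner (g f) c) \<noteq> \<epsilon> f) = (B (p h) (move_corner (g h) c') \<noteq> \<epsilon> h)"
      by (elim exE)
    \<comment> \<open>Exchanging the colours of a whole tangle affects no equality inside it; only
      the gluings have to be checked, and these are the conclusion of \<open>adjust\<close>.\<close>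
    define \<chi>' where "\<chi>' = (\<lambda>(f, d). \<chi> (p f, d) \<noteq> \<epsilon> f)"
    have "T'.matched \<chi>'"
      unfolding T'.matched_def
    proof (intro conjI ballI allI impI)
      show "\<chi>' (f, twin (T' f) d) = \<chi>' (f, d)" if "f \<in> F" "d \<in> darts (T' f)" for f d
        using that \<chi>(1) pq by (simp add: matched_def \<chi>'_def act act_simps)
      show "\<chi>' (f, stub (T' f) c) = \<chi>' (h, stub (T' h) c')" if j: "joined f c h c'" for f c h c'
      proof -
        have "f \<in> F" "h \<in> F" using j by (simp_all add: joined_def)
        with \<epsilon>[rule_format, OF j] show ?thesis by (simp add: \<chi>'_def act act_simps B_def)
      qed
    qed
    note twin' = T'.matched_twin_fill[OF this]
    have mem_kx: "(f, d) \<in> ?k ` x \<longleftrightarrow> (p f, d) \<in> x" if "f \<in> F" for f d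
      using that pq v(1) by (force simp: mem_x v(3))
    have "halving (fill TK F T') (?k ` x) \<chi>'"
      unfolding halving_def T'.darts_fill
    proof (intro ballI conjI)
      fix y assume y: "y \<in> fill_darts F T'"
      then show "\<chi>' (twin (fill TK F T') y) = \<chi>' y" by (rule twin')
      obtain f d where fd: "y = (f, d)" "f \<in> F" "d \<in> inner (T (p f))"
        using y by (auto simp: fill_darts_def inner')
      have "rot (T' f) (rot (T' f) d) = rot (T (p f)) (rot (T (p f)) d)"
        using fd(2,3) pq by (simp add: act rot_rot_act tangle subsetD[OF inner_subset])
      then show "(\<chi>' (rot (fill TK F T') (rot (fill TK F T') y)) = \<chi>' y) = (y \<notin> ?k ` x)"
        using opp[of "p f" d] fd pq by (cases "\<epsilon> f") (simp_all add: T'.rot_fill \<chi>'_def mem_kx)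
    qed
    moreover have "(\<chi>' (rot (fill TK F T') (?k y)) \<longleftrightarrow> \<chi>' (?k y)) \<longleftrightarrow> (\<phi> (rot (fill TK F T) y) \<longleftrightarrow> \<phi> y)"
      if "y \<in> darts (fill TK F T) - x" for y
    proof -
      obtain f d where fd: "y = (f, d)" "f \<in> F" "d \<in> inner (T f)" "(f, d) \<notin> x"
        using \<open>y \<in> _\<close> by (auto simp: darts_fill fill_darts_def)
      have rd: "rot (T f) d \<in> inner (T f)"
        using fd rot_inner[OF tangle] by blast
      \<comment> \<open>Away from \<open>x\<close> opposite darts agree, so a bend does not
        distinguish \<open>rot\<close> from its inverse.\<close>
      have "\<chi> (f, rot (T f) (rot (T f) (rot (T f) d))) = \<chi> (f, rot (T f) d)"
        using opp[OF fd(2) rd] rot_x[OF fd(2,3)] fd(4) by simp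
      then have "\<chi> (f, rot (T' (q f)) d) = \<chi> (f, rot (T f) d)"
        using rot_act[of "g (q f)" "T f" d] act[of "q f"] pq[OF fd(2)] by auto
      moreover have "\<chi> (f, rot (T f) d) = \<phi> (f, rot (T f) d)" "\<chi> (f, d) = \<phi> (f, d)"
        using \<chi>(2) fd rd by (simp_all add: fill_darts_def)
      ultimately show ?thesis
        using pq[OF fd(2)] by (auto simp: fd(1) rot_fill T'.rot_fill \<chi>'_def)
    qed
    ultimately show ?thesis by blast
  qed
  have "?k ` vertex (fill TK F T) y = vertex (fill TK F T') (?k y)" if "y \<in> fill_darts F T" for y
    using vertex[of "fst y" "snd y"] that by (simp add: case_prod_beta)
  with bij halving show ?thesis
    unfolding halving_map_def by (intro conjI ballI allI impI) (simp_all only: darts_fill T'.darts_fill)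
qed

text \<open>
  An even boundary colouring is, up to exchanging the two colours, invariant under the symmetries.
\<close>

lemma adjust_classical:
  fixes B :: "'a \<Rightarrow> corner \<Rightarrow> bool"
  assumes f0: "f\<^sub>0 \<in> F"
    and B_even: "\<And>f. f \<in> F \<Longrightarrow> (B f NW = B f NE) = (B f SE = B f SW)"
    and B_joined: "\<And>f c h c'. joined f c h c' \<Longrightarrow> B f c = B h c'"
  shows "\<exists>\<epsilon>. \<forall>f c h c'. joined f c h c' \<longrightarrow>
    (B f (move_corner (if f = f\<^sub>0 then g else Ident) c) \<noteq> \<epsilon> f) =
    (B h (move_corner (if h = f\<^sub>0 then g else Ident) c') \<noteq> \<epsilon> h)"
proof -
  \<comment> \<open>The colours are constant or split the corners into two pairs. The symmetries act
    as the Klein four-group and preserve every such splitting, so the corner NW decides whether the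
    colours are exchanged.\<close>
  define \<epsilon> where "\<epsilon> f \<longleftrightarrow> f = f\<^sub>0 \<and> B f (move_corner g NW) \<noteq> B f NW" for f
  have "(B f (move_corner (if f = f\<^sub>0 then g else Ident) c) \<noteq> \<epsilon> f) = B f c" if "f \<in> F" for f c
    using B_even[OF that] by (cases g; cases c) (auto simp: \<epsilon>_def)
  with B_joined show ?thesis
    by (intro exI[of _ \<epsilon>]) (simp add: joined_def)
qed

text \<open>
  Along a bundle \<open>B f NW \<noteq> B f SW\<close> does not depend on the tangle, and \<open>B f NW \<noteq> B f NE\<close> is
  invariant under \<open>Hor\<close> and under exchanging the colours. So the colours at the eastern end, being
  determined by those at the western end and a sum modulo 2 over the tangles, do not depend on the
  order of the tangles.
\<close>

lemma adjust_bundle: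
  fixes B :: "'a \<Rightarrow> corner \<Rightarrow> bool"
  assumes chain: "is_bundle TK F fs" and p: "p permutes set fs" and U: "U \<subseteq> set fs"
    and B_even: "\<And>f. f \<in> F \<Longrightarrow> (B f NW = B f NE) = (B f SE = B f SW)"
    and B_joined: "\<And>f c h c'. joined f c h c' \<Longrightarrow> B f c = B h c'"
  shows "\<exists>\<epsilon>. \<forall>f c h c'. joined f c h c' \<longrightarrow>
    (B (p f) (move_corner (if f \<in> U then Hor else Ident) c) \<noteq> \<epsilon> f) =
    (B (p h) (move_corner (if h \<in> U then Hor else Ident) c') \<noteq> \<epsilon> h)"
proof -
  define m where "m = length fs"
  have fs: "distinct fs" "set fs \<subseteq> F" using chain by (auto simp: is_bundle_def)
  have in_F: "fs ! i \<in> F" if "i < m" for i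
    using that fs(2) by (auto simp: m_def)
  have joined_E: "joined (fs ! i) NE (fs ! Suc i) NW" "joined (fs ! i) SE (fs ! Suc i) SW"
    if "Suc i < m" for i
    using that chain in_F by (auto simp: is_bundle_def joined_def m_def)
  define t where "t f \<longleftrightarrow> B f NW \<noteq> B f NE" for f
  define \<delta> where "\<delta> \<longleftrightarrow> B (fs ! 0) NW \<noteq> B (fs ! 0) SW"
  have "i < m \<Longrightarrow> (B (fs ! i) NW \<noteq> B (fs ! i) SW) = \<delta>" for i
  proof (induct i)
    case (Suc i)
    then show ?case
      using B_joined[OF joined_E(1)[of i]] B_joined[OF joined_E(2)[of i]] B_even[OF in_F[of i]] by auto
  qed (simp add: \<delta>_def)
  then have \<delta>: "(B f NW \<noteq> B f SW) = \<delta>" if "f \<in> set fs" for f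
    using that unfolding in_set_conv_nth m_def by blast
  have \<delta>_E: "(B f NE \<noteq> B f SE) = \<delta>" if "f \<in> set fs" for f
    using \<delta>[OF that] B_even[of f] that fs(2) by auto

  \<comment> \<open>\<open>u r i\<close> is the colour required at the NW corner of place
    \<open>i\<close> if the tangles stand in the order given by \<open>r\<close> and the western end
    keeps its colour; \<open>t\<close> records the change across a tangle. For \<open>r = id\<close>
    these are the old colours.\<close>
  define u where "u r i \<longleftrightarrow> (B (fs ! 0) NW \<noteq> odd (\<Sum>j<i. of_bool (t (r (fs ! j))) :: nat))"
    for r :: "'a \<Rightarrow> 'a" and i
  have u_0: "u r 0 = B (fs ! 0) NW" for r by (simp add: u_def)
  have u_Suc: "u r (Suc i) = (u r i \<noteq> t (r (fs ! i)))" for r i by (auto simp: u_def)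
  have u_id: "i < m \<Longrightarrow> u id i = B (fs ! i) NW" for i
  proof (induct i)
    case (Suc i)
    then show ?case using B_joined[OF joined_E(1)[of i]] by (simp add: u_Suc t_def) blast
  qed (simp add: u_0)
  have total: "(\<Sum>j<m. of_bool (t (r (fs ! j))) :: nat) = (\<Sum>f\<in>set fs. of_bool (t (r f)))" for r
    using sum.reindex_bij_betw[OF bij_betw_nth[OF fs(1) refl refl], of "\<lambda>f. of_bool (t (r f)) :: nat"]
    by (simp add: m_def)
  have "u p m = u id m"
    using sum.permute[OF p, of "\<lambda>f. of_bool (t f) :: nat"] 
    unfolding u_def total by (simp only: o_def id_apply)
  then have u_end: "u p (Suc i) = B (fs ! i) NE" if "Suc i = m" for i
    using that u_id[of i] u_Suc[of id i] by (auto simp: t_def)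

  define pos where "pos = the_inv_into {..<m} ((!) fs)"
  have pos: "pos (fs ! i) = i" if "i < m" for i
    using that fs(1) unfolding pos_def
    by (intro the_inv_into_f_f) (auto simp: m_def inj_on_nth)
  define g where "g f = (if f \<in> U then Hor else Ident)" for f
  \<comment> \<open>Exchange the colours so that NW gets the prescribed value. The other corners
    then follow: SW by \<open>\<delta>\<close>, NE by \<open>t\<close> and SE by evenness, whether
    or not the tangle is turned over.\<close>
  define \<epsilon> where "\<epsilon> f \<longleftrightarrow> f \<in> set fs \<and> B (p f) (move_corner (g f) NW) \<noteq> u p (pos f)" for f
  define B' where "B' f c \<longleftrightarrow> B (p f) (move_corner (g f) c) \<noteq> \<epsilon> f" for f c
  have B': "B' (fs ! i) NW = u p i" "B' (fs ! i) SW = (u p i \<noteq> \<delta>)"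
    "B' (fs ! i) NE = u p (Suc i)" "B' (fs ! i) SE = (u p (Suc i) \<noteq> \<delta>)" if i: "i < m" for i
  proof -
    have f: "fs ! i \<in> set fs" using i by (simp add: m_def)
    then have pf: "p (fs ! i) \<in> set fs" using permutes_in_image[OF p] by simp
    then have "p (fs ! i) \<in> F" using fs(2) by blast
    note facts = \<delta>[OF pf] \<delta>_E[OF pf] B_even[OF this]
    show "B' (fs ! i) NW = u p i" "B' (fs ! i) SW = (u p i \<noteq> \<delta>)"
      "B' (fs ! i) NE = u p (Suc i)" "B' (fs ! i) SE = (u p (Suc i) \<noteq> \<delta>)"
      unfolding B'_def \<epsilon>_def u_Suc t_def pos[OF i] g_def using f facts
      by (cases "fs ! i \<in> U"; simp; blast)+
  qed
  define internal where "internal f c h c' \<longleftrightarrow> (\<exists>i. Suc i < m \<and> f = fs ! i \<and> h = fs ! Suc i \<and>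
    (c = NE \<and> c' = NW \<or> c = SE \<and> c' = SW))" for f c h c'
  have internal: "B' f c = B' h c'" if "internal f c h c'" for f c h c'
    using that B' unfolding internal_def by fastforce
  \<comment> \<open>Outside the joints between neighbours every corner keeps its old colour: at the
    western end by choice, at the eastern end by \<open>u_end\<close>. This also covers a bundle
    whose ends are joined to each other.\<close>
  have external: "internal f c h c' \<or> internal h c' f c \<or> B' f c = B f c"
    if j: "joined f c h c'" for f c h c'
  proof (cases "f \<in> set fs")
    case False
    then have "p f = f" "g f = Ident" "\<not> \<epsilon> f"
      using permutes_not_in[OF p] U by (auto simp: g_def \<epsilon>_def)
    then show ?thesis by (simp add: B'_def)
  next
    case True
    then obtain i where i: "i < m" "f = fs ! i" by (auto simp: in_set_conv_nth m_def)
    have west: "internal h c' f c \<or> i = 0" if "c = NW \<or> c = SW"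
    proof (cases i)
      case (Suc k)
      have "(h, c') = (fs ! k, NE) \<and> c = NW \<or> (h, c') = (fs ! k, SE) \<and> c = SW"
        using joined_sym[OF joined_E(1)[of k]] joined_sym[OF joined_E(2)[of k]]
          joined_unique[OF j] that i Suc by blast
      then show ?thesis using i Suc unfolding internal_def by blast
    qed simp
    have east: "internal f c h c' \<or> Suc i = m" if "c = NE \<or> c = SE"
    proof (cases "Suc i = m")
      case False
      then have "Suc i < m" using i by simp
      moreover from this have "(h, c') = (fs ! Suc i, NW) \<and> c = NE \<or> (h, c') = (fs ! Suc i, SW) \<and> c = SE"
        using joined_E[of i] joined_unique[OF j] that i by blast
      ultimately show ?thesis using i unfolding internal_def by blast
    qed simp
    show ?thesis
    proof (cases c)
      case NW
      then show ?thesis using west B'(1)[OF i(1)] u_0 i by auto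
    next
      case SW
      then show ?thesis using west B'(2)[OF i(1)] u_0 i \<delta>_def by auto
    next
      case NE
      then show ?thesis using east B'(3)[OF i(1)] u_end i by auto
    next
      case SE
      then show ?thesis using east B'(4)[OF i(1)] u_end i \<delta>_E[OF True] by auto
    qed
  qed
  have "B' f c = B' h c'" if j: "joined f c h c'" for f c h c'
    using external[OF j] external[OF joined_sym[OF j]] internal B_joined[OF j] by metis
  then show ?thesis
    unfolding B'_def g_def by blast
qed

end

section \<open>Mutations of diagrams and their compositions\<close>

lemma decomposition_filling: "decomposition TK F T D \<Longrightarrow> filling TK F T"
  by unfold_locales (auto simp: decomposition_def spherical_def)

lemma decomposition_halving_map:
  assumes D: "decomposition TK F T D" and D': "decomposition TK F T' D'" and fv: "four_valent D"
    and k: "halving_map (fill TK F T) (fill TK F T') k"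
  obtains l where "halving_map D D' l"
proof -
  interpret T: filling TK F T by (rule decomposition_filling) (rule D)
  interpret T': filling TK F T' by (rule decomposition_filling) (rule D')
  have iso: "diagram_iso (fill TK F T) D" "diagram_iso (fill TK F T') D'"
    using D D' by (simp_all add: decomposition_def)
  obtain h where h: "halving_map D (fill TK F T) h"
    using diagram_iso_halving_map[OF diagram_iso_sym[OF iso(1) T.closed_fill] four_valent_closed[OF fv]] .
  obtain h' where h': "halving_map (fill TK F T') D' h'"
    using diagram_iso_halving_map[OF iso(2) T'.closed_fill] .
  show ?thesis
    by (rule that) (rule halving_map_trans[OF fv halving_map_trans[OF fv h k] h'])
qed

lemma classical_mutation_halving_map:
  assumes "classical_mutation D D'" and "four_valent D"
  obtains k where "halving_map D D' k"
proof -
  obtain TK :: "nat projection" and F and T :: "nat \<Rightarrow> nat tangle" and f g where f: "f \<in> F"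
    and D: "decomposition TK F T D" "decomposition TK F (T(f := act g (T f))) D'"
    using assms(1) unfolding classical_mutation_def by blast
  interpret filling TK F T by (rule decomposition_filling) (rule D)
  have "halving_map (fill TK F T) (fill TK F (T(f := act g (T f)))) (\<lambda>(h, d). (id h, d))"
    by (rule halving_map_fill[where p = id and g = "\<lambda>h. if h = f then g else Ident"])
      (use decomposition_filling[OF D(2)] adjust_classical[OF f] in \<open>simp_all add: act_Ident\<close>)
  then show ?thesis
    by (rule decomposition_halving_map[OF D assms(2)]) (rule that)
qed

lemma bundle_permutation_halving_map:
  assumes "bundle_permutation D D'" and "four_valent D"
  obtains k where "halving_map D D' k"
proof -
  obtain TK :: "nat projection" and F and T :: "nat \<Rightarrow> nat tangle" and fs p U
    where fs: "is_bundle TK F fs" "p permutes set fs" "U \<subseteq> set fs" and D: "decomposition TK F T D"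
      "decomposition TK F (\<lambda>f. act (if f \<in> U then Hor else Ident) (T (p f))) D'"
    using assms(1) unfolding bundle_permutation_def by blast
  interpret filling TK F T by (rule decomposition_filling) (rule D)
  have "p permutes F"
    using fs by (auto simp: is_bundle_def intro: permutes_subset)
  then have pq: "p f \<in> F \<and> inv p f \<in> F \<and> p (inv p f) = f \<and> inv p (p f) = f" if "f \<in> F" for f
    using that by (simp add: permutes_in_image permutes_inverses permutes_inv)
  have "halving_map (fill TK F T) (fill TK F (\<lambda>f. act (if f \<in> U then Hor else Ident) (T (p f))))
      (\<lambda>(f, d). (inv p f, d))"
    by (rule halving_map_fill[where p = p, OF decomposition_filling[OF D(2)] refl pq adjust_bundle[OF fs]])
  then show ?thesis
    by (rule decomposition_halving_map[OF D assms(2)]) (rule that)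
qed

lemma mutation_step_halving_map:
  assumes "mutation_step D D'"
  obtains k where "halving_map D D' k"
proof -
  have fv: "four_valent D"
    using assms by (simp add: mutation_step_def knot_four_valent)
  from assms consider "diagram_iso D D'" | "classical_mutation D D'" | "bundle_permutation D D'"
    by (auto simp: mutation_step_def)
  then show ?thesis
  proof cases
    case 1
    then show ?thesis using diagram_iso_halving_map four_valent_closed[OF fv] that by blast
  next
    case 2
    then show ?thesis using classical_mutation_halving_map fv that by blast
  next
    case 3
    then show ?thesis using bundle_permutation_halving_map fv that by blast
  qed
qed

lemma halving_map_refl: "halving_map M M id"
  by (auto simp: halving_map_def)

lemma extended_mutation_halving_map:
  assumes "extended_mutation K K'" and "four_valent K"
  shows "\<exists>k. halving_map K K' k"
  using assms(1) unfolding extended_mutation_def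
proof induct
  case base
  show ?case using halving_map_refl by blast
next
  case (step D D')
  obtain l where "halving_map D D' l"
    using mutation_step_halving_map[OF step(2)] .
  with step(3) show ?case using halving_map_trans[OF assms(2)] by blast
qed

theorem mainTheorem3:
  fixes K K' :: "nat diagram"
  assumes "alternating_knot K" and "alternating_knot K'"
    and "extended_mutation K K'"
  shows "graph_iso (LG K) (LG K')"
proof -
  have knots: "knot_diagram K" "knot_diagram K'"
    using assms(1,2) by (simp_all add: alternating_knot_def)
  obtain k where "halving_map K K' k"
    using extended_mutation_halving_map[OF assms(3) knot_four_valent[OF knots(1)]] by blast
  with knots show ?thesis by (rule graph_iso_LG)
qed

end
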